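(* Let $X=\{X_t:t\in\mathbb{Z}\}$ be a zero-mean weakly stationary functional time series with values in a separable complex Hilbert space $H$. Then there exists a right-continuous functional orthogonal increment process $\{Z_\omega:-\pi\le\omega\le\pi\}$ with $Z_{-\pi}\equiv 0\in H$ such that, for every $t\in\mathbb{Z}$, $$X_t=\int_{-\pi}^{\pi}e^{\mathrm{i}t\omega}\,dZ_\omega\qquad\text{a.s.}$$
   Context: $(\Omega,\mathcal{A},\mathbb{P})$ is a probability space and $\mathbb{H}=L^2_H(\Omega,\mathbb{P})$ is the Hilbert space of $H$-valued random elements $Y$ with $\mathbb{E}\|Y\|^2<\infty$, with inner product $\langle Y,W\rangle_{\mathbb{H}}=\mathbb{E}\langle Y,W\rangle$ and norm $\|\cdot\|_{\mathbb{H}}$. For $x,y\in H$, $x\otimes y$ is the rank-one operator $g\mapsto\langle g,y\rangle x$. A sequence $X=\{X_t:t\in\mathbb{Z}\}$ of $H$-valued random elements is weakly stationary if $\mathbb{E}\|X_t\|^2<\infty$ for all $t$, $\mathbb{E}X_t=m$ does not depend on $t$, and $\mathbb{E}(X_t\otimes X_s)=\mathbb{E}(X_{t-s}\otimes X_0)$ for all $t,s\in\mathbb{Z}$; zero-mean means $m=0$. $S_1(H)^+$ is the cone of non-negative definite trace class operators on $H$. A functional orthogonal increment process is an $H$-valued process $\{Z_\omega:-\pi\le\omega\le\pi\}$ such that for all $g_1,g_2\in H$ and $-\pi\le\omega\le\pi$: (i) $\mathbb{E}(Z_\omega\otimes Z_\omega)\in S_1(H)^+$; (ii) $\mathbb{E}\langle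 Z_\omega,g_1\rangle=0$; (iii) $\langle\mathbb{E}((Z_{\omega_4}-Z_{\omega_3})\otimes(Z_{\omega_2}-Z_{\omega_1}))g_1,g_2\rangle=0$ whenever $(\omega_1,\omega_2]\cap(\omega_3,\omega_4]=\emptyset$; (iv) $\langle\mathbb{E}((Z_{\omega+\varepsilon}-Z_\omega)\otimes(Z_{\omega+\varepsilon}-Z_\omega))g_1,g_2\rangle\to0$ as $\varepsilon\downarrow0$. Right-continuity of $Z$ is understood in mean square, i.e. $\|Z_{\omega+\varepsilon}-Z_\omega\|_{\mathbb{H}}\to0$ as $\varepsilon\downarrow0$. The stochastic integral $\int_{-\pi}^{\pi}e^{\mathrm{i}t\omega}\,dZ_\omega$ is the Riemann--Stieltjes limit in $\mathbb{H}$ of the sums $\sum_{i=0}^{n}e^{\mathrm{i}t\omega_i}(Z_{\omega_{i+1}}-Z_{\omega_i})$ over partitions $-\pi=\omega_0<\omega_1<\dots<\omega_{n+1}=\pi$ as the mesh of the partition tends to $0$. *)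

theory Defs
  imports "HOL-Probability.Probability"
begin

(* Complex inner product spaces, with an inner product that is linear in the FIRST and conjugate
   linear in the second argument; this is the convention under which the map
   g |-> <g,y> x is a (complex) linear operator.  A separable complex Hilbert space is a type of
   sort {complex_inner, banach, second_countable_topology}: for metrizable spaces separability and
   second countability coincide. *)

class complex_inner = real_normed_vector +
  fixes scaleC :: "complex \<Rightarrow> 'a \<Rightarrow> 'a" (infixr \<open>*\<^sub>C\<close> 75)
    and cinner :: "'a \<Rightarrow> 'a \<Rightarrow> complex"
  assumes scaleR_scaleC: "r *\<^sub>R x = complex_of_real r *\<^sub>C x"
    and scaleC_add_right: "a *\<^sub>C (x + y) = a *\<^sub>C x + a *\<^sub>C y"
    and scaleC_add_left: "(a + b) *\<^sub>C x = a *\<^sub>C x + b *\<^sub>C x"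
    and scaleC_scaleC: "a *\<^sub>C (b *\<^sub>C x) = (a * b) *\<^sub>C x"
    and cinner_commute: "cinner x y = cnj (cinner y x)"
    and cinner_add_left: "cinner (x + y) z = cinner x z + cinner y z"
    and cinner_scaleC_left: "cinner (a *\<^sub>C x) y = a * cinner x y"
    and cinner_ge_zero: "0 \<le> Re (cinner x x)"
    and cinner_eq_zero_iff: "cinner x x = 0 \<longleftrightarrow> x = 0"
    and norm_eq_sqrt_cinner: "norm x = sqrt (Re (cinner x x))"

instantiation complex :: complex_inner
begin

definition scaleC_complex :: "complex \<Rightarrow> complex \<Rightarrow> complex"
  where "scaleC_complex a x = a * x"

definition cinner_complex :: "complex \<Rightarrow> complex \<Rightarrow> complex"
  where "cinner_complex x y = x * cnj y"

instance
proof
  fix r :: real and a b x y z :: complex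
  show "r *\<^sub>R x = complex_of_real r *\<^sub>C x"
    by (simp add: scaleC_complex_def scaleR_conv_of_real)
  show "a *\<^sub>C (x + y) = a *\<^sub>C x + a *\<^sub>C y" "(a + b) *\<^sub>C x = a *\<^sub>C x + b *\<^sub>C x"
    "a *\<^sub>C (b *\<^sub>C x) = (a * b) *\<^sub>C x"
    by (simp_all add: scaleC_complex_def algebra_simps)
  show "cinner x y = cnj (cinner y x)" "cinner (x + y) z = cinner x z + cinner y z"
    "cinner (a *\<^sub>C x) y = a * cinner x y"
    by (simp_all add: cinner_complex_def scaleC_complex_def algebra_simps)
  show "0 \<le> Re (cinner x x)" "cinner x x = 0 \<longleftrightarrow> x = 0" "norm x = sqrt (Re (cinner x x))"
    by (simp_all add: cinner_complex_def cmod_def power2_eq_square)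
qed

end


section \<open>Operators\<close>

definition bounded_clinear :: "('h::complex_inner \<Rightarrow> 'h) \<Rightarrow> bool"
  where "bounded_clinear T \<longleftrightarrow> bounded_linear T \<and> (\<forall>c x. T (c *\<^sub>C x) = c *\<^sub>C T x)"

definition nonneg_definite :: "('h::complex_inner \<Rightarrow> 'h) \<Rightarrow> bool"
  where "nonneg_definite T \<longleftrightarrow> (\<forall>x. cinner (T x) x \<in> \<real>\<^sub>\<ge>\<^sub>0)"

definition orthonormal_basis :: "'h::complex_inner set \<Rightarrow> bool"
  where "orthonormal_basis E \<longleftrightarrow>
    (\<forall>e\<in>E. \<forall>f\<in>E. cinner e f = (if e = f then 1 else 0)) \<and>
    (\<forall>x. (\<forall>e\<in>E. cinner x e = 0) \<longrightarrow> x = 0)"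

(* A is the modulus |T| = (T* T)^(1/2): the bounded non-negative definite operator A with
   A A = T* T.  As A is self-adjoint, the equation is tested by <A (A x), y> = <T x, T y>. *)
definition is_modulus :: "('h::complex_inner \<Rightarrow> 'h) \<Rightarrow> ('h \<Rightarrow> 'h) \<Rightarrow> bool"
  where "is_modulus T A \<longleftrightarrow> bounded_clinear A \<and> nonneg_definite A \<and>
    (\<forall>x y. cinner (A (A x)) y = cinner (T x) (T y))"

(* T is trace class iff |T| has finite trace, computed in any orthonormal basis. *)
definition trace_class :: "('h::complex_inner \<Rightarrow> 'h) \<Rightarrow> bool"
  where "trace_class T \<longleftrightarrow> bounded_clinear T \<and>
    (\<exists>A. is_modulus T A \<and>
      (\<forall>E. orthonormal_basis E \<longrightarrow> (\<lambda>e. cinner (A e) e) summable_on E))"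

definition trace_class_nonneg :: "('h::complex_inner \<Rightarrow> 'h) set"
  where "trace_class_nonneg = {T. trace_class T \<and> nonneg_definite T}"

definition tensor_op :: "'h::complex_inner \<Rightarrow> 'h \<Rightarrow> 'h \<Rightarrow> 'h" (infixl \<open>\<otimes>\<^sub>H\<close> 70)
  where "(x \<otimes>\<^sub>H y) = (\<lambda>g. cinner g y *\<^sub>C x)"


section \<open>Square-integrable random elements\<close>

definition L2_elements ::
  "'o measure \<Rightarrow> ('o \<Rightarrow> 'h::{complex_inner, banach, second_countable_topology}) set"
  where "L2_elements M = {Y. Y \<in> borel_measurable M \<and> integrable M (\<lambda>w. (norm (Y w))\<^sup>2)}"

definition L2_norm ::
  "'o measure \<Rightarrow> ('o \<Rightarrow> 'h::{complex_inner, banach, second_countable_topology}) \<Rightarrow> real"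
  where "L2_norm M Y = sqrt (integral\<^sup>L M (\<lambda>w. (norm (Y w))\<^sup>2))"

(* The operator-valued expectation of Y (x) W, given by its values at g: evaluation at g is a
   bounded linear map, hence commutes with the Bochner integral. *)
definition expect_tensor ::
  "'o measure \<Rightarrow> ('o \<Rightarrow> 'h::{complex_inner, banach, second_countable_topology}) \<Rightarrow>
    ('o \<Rightarrow> 'h) \<Rightarrow> 'h \<Rightarrow> 'h"
  where "expect_tensor M Y W = (\<lambda>g. integral\<^sup>L M (\<lambda>w. (Y w \<otimes>\<^sub>H W w) g))"


section \<open>Weakly stationary functional time series\<close>

definition weakly_stationary ::
  "'o measure \<Rightarrow> (int \<Rightarrow> 'o \<Rightarrow> 'h::{complex_inner, banach, second_countable_topology}) \<Rightarrow> bool"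
  where "weakly_stationary M X \<longleftrightarrow>
    (\<forall>t. X t \<in> L2_elements M) \<and>
    (\<exists>m. \<forall>t. integral\<^sup>L M (X t) = m) \<and>
    (\<forall>t s. expect_tensor M (X t) (X s) = expect_tensor M (X (t - s)) (X 0))"

definition zero_mean ::
  "'o measure \<Rightarrow> (int \<Rightarrow> 'o \<Rightarrow> 'h::{complex_inner, banach, second_countable_topology}) \<Rightarrow> bool"
  where "zero_mean M X \<longleftrightarrow> (\<forall>t. integral\<^sup>L M (X t) = 0)"


section \<open>Functional orthogonal increment processes on [-pi, pi]\<close>

(* Only the values Z a with -pi \<le> a \<le> pi are relevant.  The order a1 \<le> a2, a3 \<le> a4 is implicit
   in the interval notation of condition (iii); without it, reversed end points would give empty
   intervals and force the increments to vanish. *)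
definition orthogonal_increment_process ::
  "'o measure \<Rightarrow> (real \<Rightarrow> 'o \<Rightarrow> 'h::{complex_inner, banach, second_countable_topology}) \<Rightarrow> bool"
  where "orthogonal_increment_process M Z \<longleftrightarrow>
    (\<forall>a\<in>{-pi..pi}. Z a \<in> L2_elements M) \<and>
    (\<forall>a\<in>{-pi..pi}. expect_tensor M (Z a) (Z a) \<in> trace_class_nonneg) \<and>
    (\<forall>a\<in>{-pi..pi}. \<forall>g. integral\<^sup>L M (\<lambda>w. cinner (Z a w) g) = 0) \<and>
    (\<forall>a1\<in>{-pi..pi}. \<forall>a2\<in>{-pi..pi}. \<forall>a3\<in>{-pi..pi}. \<forall>a4\<in>{-pi..pi}.
      a1 \<le> a2 \<longrightarrow> a3 \<le> a4 \<longrightarrow> {a1<..a2} \<inter> {a3<..a4} = {} \<longrightarrow>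
      (\<forall>g1 g2. cinner (expect_tensor M (\<lambda>w. Z a4 w - Z a3 w) (\<lambda>w. Z a2 w - Z a1 w) g1) g2 = 0)) \<and>
    (\<forall>a\<in>{-pi..<pi}. \<forall>g1 g2.
      ((\<lambda>\<epsilon>. cinner (expect_tensor M (\<lambda>w. Z (a + \<epsilon>) w - Z a w) (\<lambda>w. Z (a + \<epsilon>) w - Z a w) g1) g2)
        \<longlongrightarrow> 0) (at_right 0))"

definition ms_right_continuous ::
  "'o measure \<Rightarrow> (real \<Rightarrow> 'o \<Rightarrow> 'h::{complex_inner, banach, second_countable_topology}) \<Rightarrow> bool"
  where "ms_right_continuous M Z \<longleftrightarrow>
    (\<forall>a\<in>{-pi..<pi}. ((\<lambda>\<epsilon>. L2_norm M (\<lambda>w. Z (a + \<epsilon>) w - Z a w)) \<longlongrightarrow> 0) (at_right 0))"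


section \<open>The stochastic integral\<close>

(* The points p 0 < ... < p (n + 1); the values of p beyond n + 1 are irrelevant. *)
definition is_partition :: "nat \<Rightarrow> (nat \<Rightarrow> real) \<Rightarrow> bool"
  where "is_partition n p \<longleftrightarrow> p 0 = -pi \<and> p (n + 1) = pi \<and> (\<forall>i\<le>n. p i < p (i + 1))"

definition mesh :: "nat \<Rightarrow> (nat \<Rightarrow> real) \<Rightarrow> real"
  where "mesh n p = Max ((\<lambda>i. p (i + 1) - p i) ` {..n})"

definition stieltjes_sum ::
  "(real \<Rightarrow> complex) \<Rightarrow> (real \<Rightarrow> 'o \<Rightarrow> 'h::complex_inner) \<Rightarrow> nat \<Rightarrow> (nat \<Rightarrow> real) \<Rightarrow> 'o \<Rightarrow> 'h"
  where "stieltjes_sum f Z n p = (\<lambda>w. \<Sum>i\<le>n. f (p i) *\<^sub>C (Z (p (i + 1)) w - Z (p i) w))"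

(* The integral is an element of the L2 space, hence determined only almost surely; I ranges over
   its versions. *)
definition has_stochastic_integral ::
  "'o measure \<Rightarrow> (real \<Rightarrow> complex) \<Rightarrow>
    (real \<Rightarrow> 'o \<Rightarrow> 'h::{complex_inner, banach, second_countable_topology}) \<Rightarrow> ('o \<Rightarrow> 'h) \<Rightarrow> bool"
  where "has_stochastic_integral M f Z I \<longleftrightarrow>
    I \<in> L2_elements M \<and>
    (\<forall>\<epsilon>>0. \<exists>\<delta>>0. \<forall>n p. is_partition n p \<longrightarrow> mesh n p < \<delta> \<longrightarrow>
      L2_norm M (\<lambda>w. stieltjes_sum f Z n p w - I w) < \<epsilon>)"

end

theory Submission
  imports Defs
begin

text \<open>
  Write \<open>e\<^sub>t(x) = exp(\<i> t x)\<close>. The process to be found is \<open>Z\<^sub>a = J(1\<^bsub>(-\<pi>, a]\<^esub>)\<close>, where \<open>J\<close> is the linear map from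
  functions on \<open>(-\<pi>, \<pi>]\<close> to square-integrable random elements with \<open>J(e\<^sub>t) = X\<^sub>t\<close>. Most of the claim follows once \<open>J\<close> is
  known to be isometric for the norm of \<open>L\<^sup>2(\<mu>)\<close>, where \<open>\<mu>\<close> is a finite measure whose Fourier coefficients are
  the scalar autocovariances \<open>\<gamma>(h) = E\<langle>X\<^sub>h, X\<^sub>0\<rangle>\<close>. Right-continuity of \<open>Z\<close> becomes \<open>\<mu>(a, a + \<epsilon>] \<rightarrow> 0\<close>, and since
  the Riemann--Stieltjes sums are the images of step functions that converge uniformly to \<open>e\<^sub>t\<close>, they
  converge to \<open>J(e\<^sub>t) = X\<^sub>t\<close>.

  That \<open>\<gamma>\<close> depends on the lag alone follows from the stationarity of the covariance operators by taking
  traces along a Parseval sequence (\<open>Parseval_sequence_exists\<close>, \<open>weakly_stationary_L2_inner\<close>). The measure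
  comes from \<open>Herglotz\<close>: the expected periodograms are non-negative, their Fourier coefficients tend to \<open>\<gamma>\<close>,
  and Helly's selection theorem provides a weak limit point.

  Operator orthogonality of the increments is stronger than what the isometry for \<open>X\<close> gives. For a fixed
  \<open>g\<close>, however, the coordinates \<open>\<langle>X\<^sub>t, g\<rangle>\<close> form a scalar stationary sequence with its own spectral measure, and
  taking coordinates commutes with \<open>J\<close>. Hence the diagonal matrix elements of the cross-covariance operator
  of \<open>J(\<phi>)\<close> and \<open>J(\<psi>)\<close> vanish when \<open>\<phi>\<close> and \<open>\<psi>\<close> have disjoint supports, and polarisation gives the others
  (\<open>spectral_orthogonal\<close>).

  This argument needs one map \<open>J\<close> that is compatible with many measures at once. Therefore \<open>J\<close> is
  generated, as the inductive relation \<open>spectral\<close>, by linear combinations and by bounded pointwise limits,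
  which pass through every finite measure by dominated convergence; \<open>spectral_isometry\<close> is an induction
  over its rules. The indicators of arcs are such limits of trigonometric polynomials
  (\<open>trig_poly_approximates_arc\<close>), and completeness of the space of square-integrable random elements
  provides their images (\<open>spectral_limit_exists\<close>).
\<close>

section \<open>Complex inner product spaces\<close>

lemma cinner_add_right: "cinner x (y + z) = cinner x y + cinner x z"
  by (metis cinner_commute cinner_add_left complex_cnj_add)

lemma cinner_scaleC_right: "cinner x (a *\<^sub>C y) = cnj a * cinner x y"
  by (metis cinner_commute cinner_scaleC_left complex_cnj_mult)

lemma scaleC_one [simp]: "1 *\<^sub>C (x :: 'a :: complex_inner) = x"
  using scaleR_scaleC[of 1 x] by simp

lemma scaleC_zero_left [simp]: "0 *\<^sub>C (x :: 'a :: complex_inner) = 0"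
  using scaleR_scaleC[of 0 x] by simp

lemma scaleC_minus_one: "(- 1) *\<^sub>C (x :: 'a :: complex_inner) = - x"
  using scaleR_scaleC[of "-1" x] by simp

lemma scaleC_scaleR: "a *\<^sub>C (r *\<^sub>R x) = r *\<^sub>R (a *\<^sub>C x)"
  for x :: "'a :: complex_inner"
  by (simp add: scaleR_scaleC scaleC_scaleC mult.commute)

lemma cinner_scaleR_left: "cinner (r *\<^sub>R x) y = r *\<^sub>R cinner x y"
  by (simp add: scaleR_scaleC cinner_scaleC_left scaleC_complex_def)

lemma cinner_scaleR_right: "cinner x (r *\<^sub>R y) = r *\<^sub>R cinner x y"
  by (simp add: scaleR_scaleC cinner_scaleC_right scaleC_complex_def)

lemma cinner_self: "cinner x x = complex_of_real ((norm x)\<^sup>2)"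
proof (rule complex_eqI)
  show "Re (cinner x x) = Re (complex_of_real ((norm x)\<^sup>2))"
    by (simp add: norm_eq_sqrt_cinner cinner_ge_zero)
  have "cinner x x = cnj (cinner x x)"
    by (rule cinner_commute)
  then show "Im (cinner x x) = Im (complex_of_real ((norm x)\<^sup>2))"
    by (metis Im_complex_of_real cnj.simps(2) equal_neg_zero)
qed

lemma norm_scaleC: "norm (a *\<^sub>C x) = cmod a * norm x" for x :: "'a :: complex_inner"
proof -
  have "complex_of_real ((norm (a *\<^sub>C x))\<^sup>2) = a * cnj a * complex_of_real ((norm x)\<^sup>2)"
    by (simp add: cinner_self[symmetric] cinner_scaleC_left cinner_scaleC_right del: of_real_power)
  also have "\<dots> = complex_of_real ((cmod a * norm x)\<^sup>2)"
    by (simp add: complex_norm_square[symmetric] power_mult_distrib)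
  finally have "(norm (a *\<^sub>C x))\<^sup>2 = (cmod a * norm x)\<^sup>2"
    by (simp only: of_real_eq_iff)
  then show ?thesis
    by simp
qed

lemma norm_add_square:
  "(norm (x + y))\<^sup>2 = (norm x)\<^sup>2 + 2 * Re (cinner x y) + (norm y)\<^sup>2" for x :: "'a :: complex_inner"
proof -
  have "Re (cinner y x) = Re (cinner x y)"
    by (subst cinner_commute) simp
  moreover have "(norm (x + y))\<^sup>2 = Re (cinner (x + y) (x + y))"
    by (simp add: cinner_self)
  moreover have "\<dots> = Re (cinner x x) + Re (cinner x y) + (Re (cinner y x) + Re (cinner y y))"
    by (simp add: cinner_add_left cinner_add_right)
  ultimately show ?thesis
    by (simp add: cinner_self)
qed

text \<open>Expanding \<open>\<parallel>x + y\<parallel>\<^sup>2\<close> and comparing with the triangle inequality bounds the real part;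
  rotating \<open>x\<close> so that the inner product becomes real and non-negative bounds the modulus.\<close>

lemma norm_cinner_le: "cmod (cinner x y) \<le> norm x * norm y" for x :: "'a :: complex_inner"
proof -
  have Re_le: "Re (cinner u y) \<le> norm u * norm y" for u :: 'a
  proof -
    have "(norm (u + y))\<^sup>2 \<le> (norm u + norm y)\<^sup>2"
      by (intro power_mono norm_triangle_ineq norm_ge_zero)
    then show ?thesis
      by (simp add: norm_add_square power2_sum)
  qed
  define c where "c = cnj (sgn (cinner x y))"
  have "c * cinner x y = complex_of_real (cmod (cinner x y))"
    using complex_norm_square[of "cinner x y"]
    by (cases "cinner x y = 0") (simp_all add: c_def sgn_eq field_simps power2_eq_square)
  then have "cmod (cinner x y) = Re (cinner (c *\<^sub>C x) y)"
    by (simp add: cinner_scaleC_left)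
  also have "\<dots> \<le> norm (c *\<^sub>C x) * norm y"
    by (rule Re_le)
  also have "\<dots> \<le> norm x * norm y"
    by (intro mult_right_mono) (auto simp: c_def norm_scaleC norm_sgn)
  finally show ?thesis .
qed

interpretation cinner: bounded_bilinear "cinner :: 'a :: complex_inner \<Rightarrow> 'a \<Rightarrow> complex"
proof
  show "\<exists>K. \<forall>a b :: 'a. cmod (cinner a b) \<le> norm a * norm b * K"
    by (rule exI[of _ 1]) (simp add: norm_cinner_le)
qed (simp_all add: cinner_add_left cinner_add_right cinner_scaleR_left cinner_scaleR_right)

interpretation scaleC: bounded_bilinear "scaleC :: complex \<Rightarrow> 'a :: complex_inner \<Rightarrow> 'a"
proof
  show "\<exists>K. \<forall>a (b :: 'a). norm (a *\<^sub>C b) \<le> norm a * norm b * K"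
    by (rule exI[of _ 1]) (simp add: norm_scaleC)
  show "(r *\<^sub>R a) *\<^sub>C b = r *\<^sub>R (a *\<^sub>C b)" for r a and b :: 'a
    by (simp only: scaleR_conv_of_real scaleC_scaleC[symmetric] scaleR_scaleC[of r "a *\<^sub>C b"])
qed (simp_all add: scaleC_add_left scaleC_add_right scaleC_scaleR)

lemma borel_measurable_cinner [measurable (raw)]:
  fixes f g :: "'b \<Rightarrow> 'a :: {complex_inner, second_countable_topology}"
  assumes "f \<in> borel_measurable M" "g \<in> borel_measurable M"
  shows "(\<lambda>w. cinner (f w) (g w)) \<in> borel_measurable M"
  by (rule borel_measurable_continuous_Pair[OF assms]) (intro continuous_intros cinner.continuous_on)

lemma borel_measurable_scaleC [measurable (raw)]:
  fixes g :: "'b \<Rightarrow> 'a :: {complex_inner, second_countable_topology}"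
  assumes "f \<in> borel_measurable M" "g \<in> borel_measurable M"
  shows "(\<lambda>w. f w *\<^sub>C g w) \<in> borel_measurable M"
  by (rule borel_measurable_continuous_Pair[OF assms]) (intro continuous_intros scaleC.continuous_on)

text \<open>The diagonal values at \<open>x + y\<close> and at \<open>\<i> x + y\<close> isolate, up to a factor \<open>\<i>\<close>, the sum and the
  difference of \<open>s x y\<close> and \<open>s y x\<close>.\<close>

lemma sesquilinear_zero_diagonal:
  fixes s :: "'a :: complex_inner \<Rightarrow> 'a \<Rightarrow> complex"
  assumes add_left: "\<And>x y z. s (x + y) z = s x z + s y z"
    and add_right: "\<And>x y z. s z (x + y) = s z x + s z y"
    and scale_left: "\<And>c x y. s (c *\<^sub>C x) y = c * s x y"
    and scale_right: "\<And>c x y. s x (c *\<^sub>C y) = cnj c * s x y"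
    and diag: "\<And>x. s x x = 0"
  shows "s x y = 0"
proof -
  have "s x y + s y x = 0"
    using diag[of "x + y", unfolded add_left add_right] by (simp add: diag add.commute)
  moreover have "\<i> * s x y - \<i> * s y x = 0"
    using diag[of "\<i> *\<^sub>C x + y", unfolded add_left add_right scale_left scale_right]
    by (simp add: diag)
  ultimately show ?thesis
    by (simp add: algebra_simps) 
qed

subsection \<open>A Parseval sequence in a separable space\<close>

text \<open>Gram--Schmidt in terms of remainders: \<open>residual d n x\<close> is what is left of \<open>x\<close> after splitting off its
  components along the directions obtained from \<open>d 0, \<dots>, d (n - 1)\<close>. If \<open>d n\<close> brings no new direction, then
  \<open>sgn 0 = 0\<close> makes the step trivial.\<close>

primrec residual :: "(nat \<Rightarrow> 'a) \<Rightarrow> nat \<Rightarrow> 'a \<Rightarrow> 'a :: complex_inner" where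
  "residual d 0 x = x"
| "residual d (Suc n) x =
    residual d n x - cinner (residual d n x) (sgn (residual d n (d n))) *\<^sub>C sgn (residual d n (d n))"

lemma residual_diff: "residual d n (x - y) = residual d n x - residual d n y"
  by (induction n) (simp_all add: cinner.diff_left scaleC.diff_left)

lemma norm_diff_projection:
  fixes x v :: "'a :: complex_inner"
  shows "(norm (x - cinner x (sgn v) *\<^sub>C sgn v))\<^sup>2 = (norm x)\<^sup>2 - (cmod (cinner x (sgn v)))\<^sup>2"
proof -
  let ?u = "sgn v" and ?c = "cinner x (sgn v)"
  have "(norm (x + (- ?c) *\<^sub>C ?u))\<^sup>2
      = (norm x)\<^sup>2 - 2 * Re (cnj ?c * ?c) + (cmod ?c * norm ?u)\<^sup>2"
    unfolding norm_add_square by (simp add: cinner_scaleC_right norm_scaleC cinner.minus_right)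
  moreover have "(cmod ?c * norm ?u)\<^sup>2 = (cmod ?c)\<^sup>2"
    by (simp add: norm_sgn cinner.zero_right)
  moreover have "Re (cnj ?c * ?c) = (cmod ?c)\<^sup>2"
    by (metis Re_complex_of_real complex_norm_square mult.commute)
  ultimately show ?thesis
    by (simp add: scaleC.minus_left)
qed

lemma norm_residual_Suc:
  "(norm (residual d (Suc n) x))\<^sup>2
    = (norm (residual d n x))\<^sup>2 - (cmod (cinner (residual d n x) (sgn (residual d n (d n)))))\<^sup>2"
  by (simp add: norm_diff_projection)

lemma norm_residual_antimono: "m \<le> n \<Longrightarrow> norm (residual d n x) \<le> norm (residual d m x)"
proof (induction n rule: dec_induct)
  case (step n)
  have "norm (residual d (Suc n) x) \<le> norm (residual d n x)"
    by (rule power2_le_imp_le) (simp_all add: norm_residual_Suc del: residual.simps)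
  with step show ?case
    by linarith
qed simp

lemma residual_self: "residual d (Suc n) (d n) = 0"
proof -
  have "(norm (residual d (Suc n) (d n)))\<^sup>2 = 0"
  proof (cases "residual d n (d n) = 0")
    case False
    then have "cinner (residual d n (d n)) (sgn (residual d n (d n))) = norm (residual d n (d n))"
      by (simp add: sgn_div_norm cinner_scaleR_right cinner_self power2_eq_square scaleR_conv_of_real
        del: of_real_power)
    then show ?thesis
      by (simp add: norm_residual_Suc del: residual.simps)
  qed (simp add: scaleC.zero_right)
  then show ?thesis
    by simp
qed

text \<open>The coefficients that are split off are inner products with a remainder of \<open>x\<close>; this moves the
  projections to the other side and turns them into coordinates of \<open>x\<close> itself.\<close>

lemma residual_adjoint: "\<exists>y'. \<forall>x. cinner (residual d n x) y = cinner x y'"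
proof (induction n arbitrary: y)
  case (Suc n)
  let ?u = "sgn (residual d n (d n))"
  obtain y' where "\<forall>x. cinner (residual d n x) (y - cinner y ?u *\<^sub>C ?u) = cinner x y'"
    using Suc by blast
  then have "\<forall>x. cinner (residual d (Suc n) x) y = cinner x y'"
    by (simp add: cinner.diff_left cinner.diff_right cinner_scaleC_left cinner_scaleC_right
        cinner_commute[of ?u y] mult.commute)
  then show ?case
    by blast
qed auto

text \<open>The residual maps are linear contractions, and \<open>d n\<close> is annihilated from step \<open>n + 1\<close> on, so the
  remainder of \<open>x\<close> is at most the distance from \<open>x\<close> to \<open>d n\<close>.\<close>

lemma residual_tendsto_zero:
  assumes "closure (range d) = (UNIV :: 'a :: complex_inner set)"
  shows "(\<lambda>n. residual d n x) \<longlonglongrightarrow> 0"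
proof (rule LIMSEQ_I)
  fix r :: real assume "r > 0"
  then obtain n where n: "dist (d n) x < r"
    using assms closure_approachable[of x "range d"] by auto
  have "norm (residual d m x - 0) < r" if "m \<ge> Suc n" for m
  proof -
    have "norm (residual d m x) \<le> norm (residual d (Suc n) x)"
      using that by (rule norm_residual_antimono)
    also have "\<dots> = norm (residual d (Suc n) (x - d n))"
      by (simp add: residual_diff residual_self del: residual.simps)
    also have "\<dots> \<le> norm (residual d 0 (x - d n))"
      by (intro norm_residual_antimono) simp
    finally show ?thesis
      using n by (simp add: dist_norm norm_minus_commute)
  qed
  then show "\<exists>no. \<forall>n\<ge>no. norm (residual d n x - 0) < r"
    by blast
qed

text \<open>Each step of the procedure takes \<open>\<bar>\<langle>x, e n\<rangle>\<bar>\<^sup>2\<close> off the squared norm, and the remainders tend to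
  zero. In terms of such a sequence, traces of covariance operators become sums of scalar covariances.\<close>

lemma Parseval_sequence_exists:
  obtains e :: "nat \<Rightarrow> 'a :: {complex_inner, second_countable_topology}"
  where "\<And>x. (\<lambda>n. (cmod (cinner x (e n)))\<^sup>2) sums (norm x)\<^sup>2"
proof -
  obtain D :: "'a set" where D: "countable D" "\<And>U. open U \<Longrightarrow> U \<noteq> {} \<Longrightarrow> \<exists>y \<in> D. y \<in> U"
    using countable_dense_setE by blast
  then have "D \<noteq> {}"
    using open_UNIV by blast
  define d where "d = from_nat_into D"
  have "range d = D"
    unfolding d_def using \<open>D \<noteq> {}\<close> D(1) by (rule range_from_nat_into)
  then have dense: "closure (range d) = UNIV"
    using D(2)[OF open_ball, of _ _] by (force simp: closure_approachable dist_commute)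
  define u where "u n = sgn (residual d n (d n))" for n
  have "\<forall>n. \<exists>y. \<forall>x. cinner (residual d n x) (u n) = cinner x y"
    using residual_adjoint by blast
  then obtain e where e: "cinner (residual d n x) (u n) = cinner x (e n)" for n x
    by (auto dest: choice)
  have "(\<Sum>k<n. (cmod (cinner x (e k)))\<^sup>2) = (norm x)\<^sup>2 - (norm (residual d n x))\<^sup>2" for n x
    by (induction n) (simp_all add: e[symmetric] u_def norm_residual_Suc del: residual.simps(2))
  moreover have "(\<lambda>n. (norm x)\<^sup>2 - (norm (residual d n x))\<^sup>2) \<longlonglongrightarrow> (norm x)\<^sup>2 - (norm (0::'a))\<^sup>2" for x
    by (intro tendsto_intros residual_tendsto_zero dense)
  ultimately show thesis
    using that[of e] by (simp add: sums_def)
qed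

section \<open>The space of square-integrable random elements\<close>

definition L2_inner ::
  "'o measure \<Rightarrow> ('o \<Rightarrow> 'h::{complex_inner, banach, second_countable_topology}) \<Rightarrow> ('o \<Rightarrow> 'h) \<Rightarrow> complex"
  where "L2_inner M Y W = integral\<^sup>L M (\<lambda>w. cinner (Y w) (W w))"

lemma L2_elementsI:
  "Y \<in> borel_measurable M \<Longrightarrow> integrable M (\<lambda>w. (norm (Y w))\<^sup>2) \<Longrightarrow> Y \<in> L2_elements M"
  by (simp add: L2_elements_def)

lemma L2_elements_measurable: "Y \<in> L2_elements M \<Longrightarrow> Y \<in> borel_measurable M"
  by (simp add: L2_elements_def)

lemma L2_elements_integrable: "Y \<in> L2_elements M \<Longrightarrow> integrable M (\<lambda>w. (norm (Y w))\<^sup>2)"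
  by (simp add: L2_elements_def)

lemma L2_elements_add [intro]:
  assumes "Y \<in> L2_elements M" "W \<in> L2_elements M"
  shows "(\<lambda>w. Y w + W w) \<in> L2_elements M"
proof (rule L2_elementsI)
  note [measurable] = assms[THEN L2_elements_measurable]
  show "(\<lambda>w. Y w + W w) \<in> borel_measurable M"
    by measurable
  show "integrable M (\<lambda>w. (norm (Y w + W w))\<^sup>2)"
  proof (rule Bochner_Integration.integrable_bound)
    show "integrable M (\<lambda>w. 2 * (norm (Y w))\<^sup>2 + 2 * (norm (W w))\<^sup>2)"
      using assms by (auto simp: L2_elements_integrable)
    show "AE w in M. norm ((norm (Y w + W w))\<^sup>2) \<le> norm (2 * (norm (Y w))\<^sup>2 + 2 * (norm (W w))\<^sup>2)"
    proof (rule AE_I2)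
      fix w
      have "(norm (Y w + W w))\<^sup>2 \<le> (norm (Y w) + norm (W w))\<^sup>2"
        by (intro power_mono norm_triangle_ineq norm_ge_zero)
      also have "\<dots> \<le> 2 * (norm (Y w))\<^sup>2 + 2 * (norm (W w))\<^sup>2"
        using sum_squares_bound[of "norm (Y w)" "norm (W w)"] by (simp add: power2_sum)
      finally show "norm ((norm (Y w + W w))\<^sup>2) \<le> norm (2 * (norm (Y w))\<^sup>2 + 2 * (norm (W w))\<^sup>2)"
        by simp
    qed
  qed simp
qed

lemma L2_elements_scaleC [intro]:
  assumes "Y \<in> L2_elements M"
  shows "(\<lambda>w. c *\<^sub>C Y w) \<in> L2_elements M"
  using assms by (auto simp: L2_elements_def norm_scaleC power_mult_distrib)

lemma L2_elements_diff [intro]: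
  assumes "Y \<in> L2_elements M" "W \<in> L2_elements M"
  shows "(\<lambda>w. Y w - W w) \<in> L2_elements M"
  using L2_elements_add[OF assms(1) L2_elements_scaleC[OF assms(2), of "-1"]]
  by (simp add: scaleC_minus_one)

lemma L2_norm_nonneg [simp]: "0 \<le> L2_norm M Y"
  by (simp add: L2_norm_def)

lemma L2_norm_square: "(L2_norm M Y)\<^sup>2 = integral\<^sup>L M (\<lambda>w. (norm (Y w))\<^sup>2)"
  by (simp add: L2_norm_def)

lemma L2_inner_self: "L2_inner M Y Y = complex_of_real ((L2_norm M Y)\<^sup>2)"
  by (simp add: L2_inner_def L2_norm_square cinner_self del: of_real_power)

lemma nn_integral_norm_square:
  assumes "Y \<in> L2_elements M"
  shows "(\<integral>\<^sup>+ w. (ennreal (norm (Y w)))\<^sup>2 \<partial>M) = ennreal ((L2_norm M Y)\<^sup>2)"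
  using nn_integral_eq_integral[OF L2_elements_integrable[OF assms]]
  by (simp add: L2_norm_square ennreal_power)

lemma
  assumes "Y \<in> L2_elements M" "W \<in> L2_elements M"
  shows L2_integrable_norm_mult: "integrable M (\<lambda>w. norm (Y w) * norm (W w))"
    and L2_integral_norm_mult_le:
      "integral\<^sup>L M (\<lambda>w. norm (Y w) * norm (W w)) \<le> L2_norm M Y * L2_norm M W"
proof -
  note [measurable] = assms[THEN L2_elements_measurable]
  let ?f = "\<lambda>w. norm (Y w) * norm (W w)"
  have "(\<integral>\<^sup>+ w. ennreal (?f w) \<partial>M)\<^sup>2 \<le> ennreal ((L2_norm M Y)\<^sup>2) * ennreal ((L2_norm M W)\<^sup>2)"
    using Cauchy_Schwarz_nn_integral[of "\<lambda>w. ennreal (norm (Y w))" M "\<lambda>w. ennreal (norm (W w))"]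
    by (simp add: ennreal_mult nn_integral_norm_square assms)
  also have "\<dots> = (ennreal (L2_norm M Y * L2_norm M W))\<^sup>2"
    by (simp add: ennreal_power power_mult_distrib ennreal_mult)
  finally have sq: "(\<integral>\<^sup>+ w. ennreal (?f w) \<partial>M)\<^sup>2 \<le> (ennreal (L2_norm M Y * L2_norm M W))\<^sup>2" .
  have le: "(\<integral>\<^sup>+ w. ennreal (?f w) \<partial>M) \<le> ennreal (L2_norm M Y * L2_norm M W)"
  proof (cases "\<integral>\<^sup>+ w. ennreal (?f w) \<partial>M" rule: ennreal_cases)
    case (real x)
    then have "x\<^sup>2 \<le> (L2_norm M Y * L2_norm M W)\<^sup>2"
      using sq by (simp add: ennreal_power)
    then show ?thesis
      using real by (auto intro!: ennreal_leI dest: power2_le_imp_le)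
  next
    case top
    then show ?thesis
      using sq by (simp add: ennreal_power top_unique)
  qed
  show "integrable M ?f"
    using le by (intro integrableI_nonneg) (auto simp: order_le_less_trans)
  then show "integral\<^sup>L M ?f \<le> L2_norm M Y * L2_norm M W"
    using le by (subst (asm) nn_integral_eq_integral) auto
qed

lemma L2_integrable_cinner:
  assumes "Y \<in> L2_elements M" "W \<in> L2_elements M"
  shows "integrable M (\<lambda>w. cinner (Y w) (W w))"
  using assms[THEN L2_elements_measurable]
  by (intro Bochner_Integration.integrable_bound[OF L2_integrable_norm_mult[OF assms]])
    (auto intro!: AE_I2 simp: norm_cinner_le)

lemma norm_L2_inner_le:
  assumes "Y \<in> L2_elements M" "W \<in> L2_elements M"
  shows "cmod (L2_inner M Y W) \<le> L2_norm M Y * L2_norm M W"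
proof -
  have "cmod (L2_inner M Y W) \<le> integral\<^sup>L M (\<lambda>w. cmod (cinner (Y w) (W w)))"
    unfolding L2_inner_def by (rule integral_norm_bound)
  also have "\<dots> \<le> integral\<^sup>L M (\<lambda>w. norm (Y w) * norm (W w))"
    by (intro integral_mono integrable_norm L2_integrable_cinner L2_integrable_norm_mult
        norm_cinner_le assms)
  also have "\<dots> \<le> L2_norm M Y * L2_norm M W"
    by (rule L2_integral_norm_mult_le[OF assms])
  finally show ?thesis .
qed

lemma L2_inner_commute: "L2_inner M Y W = cnj (L2_inner M W Y)"
proof -
  have "L2_inner M Y W = integral\<^sup>L M (\<lambda>w. cnj (cinner (W w) (Y w)))"
    unfolding L2_inner_def by (intro Bochner_Integration.integral_cong refl cinner_commute)
  then show ?thesis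
    by (simp add: L2_inner_def)
qed

lemma L2_inner_add_left:
  assumes "Y \<in> L2_elements M" "V \<in> L2_elements M" "W \<in> L2_elements M"
  shows "L2_inner M (\<lambda>w. Y w + V w) W = L2_inner M Y W + L2_inner M V W"
  using assms by (simp add: L2_inner_def cinner_add_left L2_integrable_cinner)

lemma L2_inner_scaleC_left: "L2_inner M (\<lambda>w. c *\<^sub>C Y w) W = c * L2_inner M Y W"
  by (simp add: L2_inner_def cinner_scaleC_left)

lemma L2_inner_diff_left:
  assumes "Y \<in> L2_elements M" "V \<in> L2_elements M" "W \<in> L2_elements M"
  shows "L2_inner M (\<lambda>w. Y w - V w) W = L2_inner M Y W - L2_inner M V W"
  using assms by (simp add: L2_inner_def cinner.diff_left L2_integrable_cinner)

lemma L2_inner_tendsto_left: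
  assumes Y: "\<And>n. Y n \<in> L2_elements M" "Y' \<in> L2_elements M" and W: "W \<in> L2_elements M"
    and lim: "(\<lambda>n. L2_norm M (\<lambda>w. Y n w - Y' w)) \<longlonglongrightarrow> 0"
  shows "(\<lambda>n. L2_inner M (Y n) W) \<longlonglongrightarrow> L2_inner M Y' W"
proof -
  have "(\<lambda>n. L2_inner M (Y n) W - L2_inner M Y' W) \<longlonglongrightarrow> 0"
  proof (rule Lim_null_comparison)
    show "\<forall>\<^sub>F n in sequentially. cmod (L2_inner M (Y n) W - L2_inner M Y' W)
        \<le> L2_norm M (\<lambda>w. Y n w - Y' w) * L2_norm M W"
      using norm_L2_inner_le[OF L2_elements_diff[OF Y] W] Y W
      by (intro always_eventually allI) (simp add: L2_inner_diff_left)
    show "(\<lambda>n. L2_norm M (\<lambda>w. Y n w - Y' w) * L2_norm M W) \<longlonglongrightarrow> 0"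
      using tendsto_mult_right[OF lim, of "L2_norm M W"] by simp
  qed
  then show ?thesis
    by (simp add: LIM_zero_iff)
qed

lemma (in prob_space) L2_integrable:
  assumes "Y \<in> L2_elements M"
  shows "integrable M Y"
proof -
  have "(\<lambda>w. 1 :: complex) \<in> L2_elements M"
    by (rule L2_elementsI) auto
  from L2_integrable_norm_mult[OF assms this] show ?thesis
    using assms by (auto simp: L2_elements_measurable integrable_norm_iff)
qed

lemma (in prob_space) L2_integral_norm_le:
  assumes "Y \<in> L2_elements M"
  shows "integral\<^sup>L M (\<lambda>w. norm (Y w)) \<le> L2_norm M Y"
proof -
  have "(\<lambda>w. 1 :: complex) \<in> L2_elements M" "L2_norm M (\<lambda>w. 1 :: complex) = 1"
    by (auto intro!: L2_elementsI simp: L2_norm_def prob_space)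
  with L2_integral_norm_mult_le[OF assms, of "\<lambda>w. 1 :: complex"] show ?thesis
    by simp
qed

text \<open>Riesz--Fischer: along a subsequence with geometrically decaying increments, the increments
  are almost surely absolutely summable; Fatou's lemma turns the pointwise limit into a limit in
  mean square.\<close>

lemma (in prob_space) L2_complete:
  fixes Y :: "nat \<Rightarrow> 'a \<Rightarrow> 'h::{complex_inner, banach, second_countable_topology}"
  assumes Y: "\<And>n. Y n \<in> L2_elements M"
    and Cauchy: "\<And>e. e > 0 \<Longrightarrow> \<exists>N. \<forall>m\<ge>N. \<forall>n\<ge>N. L2_norm M (\<lambda>w. Y m w - Y n w) < e"
  obtains Z where "Z \<in> L2_elements M" "(\<lambda>n. L2_norm M (\<lambda>w. Y n w - Z w)) \<longlonglongrightarrow> 0"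
proof -
  note [measurable] = Y[THEN L2_elements_measurable]
  have "\<forall>k. \<exists>N. \<forall>m\<ge>N. \<forall>n\<ge>N. L2_norm M (\<lambda>w. Y m w - Y n w) < (1/2) ^ k"
    using Cauchy by simp
  then obtain N where N: "L2_norm M (\<lambda>w. Y m w - Y n w) < (1/2) ^ k" if "m \<ge> N k" "n \<ge> N k" for k m n
    by metis
  define r where "r k = k + (\<Sum>i\<le>k. N i)" for k
  have "N k \<le> (\<Sum>i\<le>k. N i)" for k
    by (intro member_le_sum) auto
  then have r: "r k \<ge> N k" "r (Suc k) \<ge> N k" "r k \<ge> k" for k
    by (auto simp: r_def intro: le_SucI trans_le_add1 trans_le_add2)
  define D where "D k w = Y (r (Suc k)) w - Y (r k) w" for k w
  have D_L2: "D k \<in> L2_elements M" for k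
    unfolding D_def by (intro L2_elements_diff Y)
  have [measurable]: "D k \<in> borel_measurable M" for k
    by (rule L2_elements_measurable[OF D_L2])
  have "(\<integral>\<^sup>+ w. (\<Sum>k. ennreal (norm (D k w))) \<partial>M) = (\<Sum>k. \<integral>\<^sup>+ w. ennreal (norm (D k w)) \<partial>M)"
    by (rule nn_integral_suminf) simp
  also have "\<dots> \<le> (\<Sum>k. ennreal ((1/2) ^ k))"
  proof (intro suminf_le summableI)
    fix k
    have "(\<integral>\<^sup>+ w. ennreal (norm (D k w)) \<partial>M) = ennreal (integral\<^sup>L M (\<lambda>w. norm (D k w)))"
      by (intro nn_integral_eq_integral integrable_norm L2_integrable D_L2) auto
    also have "\<dots> \<le> ennreal ((1/2) ^ k)"
    proof (rule ennreal_leI)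
      have "integral\<^sup>L M (\<lambda>w. norm (D k w)) \<le> L2_norm M (D k)"
        by (rule L2_integral_norm_le[OF D_L2])
      also have "\<dots> \<le> (1/2) ^ k"
        using N[of k "r (Suc k)" "r k"] r by (simp add: D_def[abs_def] less_imp_le)
      finally show "integral\<^sup>L M (\<lambda>w. norm (D k w)) \<le> (1/2) ^ k" .
    qed
    finally show "(\<integral>\<^sup>+ w. ennreal (norm (D k w)) \<partial>M) \<le> ennreal ((1/2) ^ k)" .
  qed
  also have "\<dots> = ennreal (\<Sum>k. (1/2) ^ k)"
    by (rule suminf_ennreal_eq) (auto intro: summable_sums summable_geometric)
  finally have "(\<integral>\<^sup>+ w. (\<Sum>k. ennreal (norm (D k w))) \<partial>M) \<noteq> \<infinity>"
    by (auto simp: top_unique)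
  then have "AE w in M. (\<Sum>k. ennreal (norm (D k w))) \<noteq> \<infinity>"
    by (intro nn_integral_PInf_AE) auto
  then have AE_conv: "AE w in M. (\<lambda>k. Y (r k) w) \<longlonglongrightarrow> lim (\<lambda>k. Y (r k) w)"
  proof eventually_elim
    case (elim w)
    then have "summable (\<lambda>k. norm (D k w))"
      by (intro summable_suminf_not_top) auto
    then have "summable (\<lambda>k. D k w)"
      by (rule summable_norm_cancel)
    then have "convergent (\<lambda>n. (\<Sum>k<n. D k w) + Y (r 0) w)"
      by (intro convergent_add convergent_const) (simp add: summable_iff_convergent)
    also have "(\<lambda>n. (\<Sum>k<n. D k w) + Y (r 0) w) = (\<lambda>n. Y (r n) w)"
      unfolding D_def by (subst sum_lessThan_telescope) simp
    finally show ?case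
      by (simp add: convergent_LIMSEQ_iff)
  qed
  define Z where "Z w = lim (\<lambda>k. Y (r k) w)" for w
  have Z_meas [measurable]: "Z \<in> borel_measurable M"
    unfolding Z_def by (rule borel_measurable_lim_metric) simp
  have dist_Z: "(\<integral>\<^sup>+ w. ennreal ((norm (Y n w - Z w))\<^sup>2) \<partial>M) \<le> ennreal (((1/2) ^ j)\<^sup>2)" if n: "n \<ge> N j" for j n
  proof -
    have "(\<integral>\<^sup>+ w. ennreal ((norm (Y n w - Z w))\<^sup>2) \<partial>M)
        = (\<integral>\<^sup>+ w. liminf (\<lambda>k. ennreal ((norm (Y n w - Y (r k) w))\<^sup>2)) \<partial>M)"
    proof (rule nn_integral_cong_AE)
      show "AE w in M. ennreal ((norm (Y n w - Z w))\<^sup>2)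
          = liminf (\<lambda>k. ennreal ((norm (Y n w - Y (r k) w))\<^sup>2))"
        using AE_conv
      proof eventually_elim
        case (elim w)
        then have "(\<lambda>k. ennreal ((norm (Y n w - Y (r k) w))\<^sup>2)) \<longlonglongrightarrow> ennreal ((norm (Y n w - Z w))\<^sup>2)"
          unfolding Z_def by (intro tendsto_intros)
        then show ?case
          by (intro lim_imp_Liminf[symmetric]) simp
      qed
    qed
    also have "\<dots> \<le> liminf (\<lambda>k. \<integral>\<^sup>+ w. ennreal ((norm (Y n w - Y (r k) w))\<^sup>2) \<partial>M)"
      by (rule nn_integral_liminf) simp
    also have "\<dots> \<le> ennreal (((1/2) ^ j)\<^sup>2)"
    proof (rule Liminf_le)
      show "\<forall>\<^sub>F k in sequentially. (\<integral>\<^sup>+ w. ennreal ((norm (Y n w - Y (r k) w))\<^sup>2) \<partial>M) \<le> ennreal (((1/2) ^ j)\<^sup>2)"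
        using eventually_ge_at_top[of "N j"]
      proof eventually_elim
        case (elim k)
        then have "L2_norm M (\<lambda>w. Y n w - Y (r k) w) < (1/2) ^ j"
          using n r(3)[of k] by (intro N) auto
        then have "(L2_norm M (\<lambda>w. Y n w - Y (r k) w))\<^sup>2 \<le> ((1/2) ^ j)\<^sup>2"
          by (intro power_mono) auto
        then show ?case
          using nn_integral_norm_square[OF L2_elements_diff[OF Y Y], of n "r k"]
          by (simp add: ennreal_power ennreal_leI del: power_divide)
      qed
    qed simp
    finally show ?thesis .
  qed
  have diff_L2: "(\<lambda>w. Y n w - Z w) \<in> L2_elements M" if "n \<ge> N j" for j n
    using dist_Z[OF that] by (intro L2_elementsI integrableI_nonneg) (auto simp: order_le_less_trans)
  have Z_L2: "Z \<in> L2_elements M"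
    using L2_elements_diff[OF Y diff_L2[OF order_refl], of "N 0" 0] by simp
  have "(\<lambda>n. L2_norm M (\<lambda>w. Y n w - Z w)) \<longlonglongrightarrow> 0"
  proof (rule LIMSEQ_I)
    fix e :: real assume "e > 0"
    then obtain j where j: "(1/2) ^ j < e"
      using real_arch_pow_inv[of e "1/2"] by auto
    have "norm (L2_norm M (\<lambda>w. Y n w - Z w) - 0) < e" if "n \<ge> N j" for n
    proof -
      have "ennreal ((L2_norm M (\<lambda>w. Y n w - Z w))\<^sup>2) \<le> ennreal (((1/2) ^ j)\<^sup>2)"
        using dist_Z[OF that] nn_integral_norm_square[OF diff_L2[OF that]] by (simp add: ennreal_power)
      then have "(L2_norm M (\<lambda>w. Y n w - Z w))\<^sup>2 \<le> ((1/2) ^ j)\<^sup>2"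
        by (subst (asm) ennreal_le_iff) (rule zero_le_power2)
      then have "L2_norm M (\<lambda>w. Y n w - Z w) \<le> (1/2) ^ j"
        by (rule power2_le_imp_le) simp
      with j show ?thesis
        by simp
    qed
    then show "\<exists>no. \<forall>n\<ge>no. norm (L2_norm M (\<lambda>w. Y n w - Z w) - 0) < e"
      by blast
  qed
  with Z_L2 show thesis
    by (rule that)
qed

section \<open>Herglotz' theorem\<close>

definition trig :: "int \<Rightarrow> real \<Rightarrow> complex"
  where "trig h x = cis (of_int h * x)"

lemma trig_zero: "trig 0 = (\<lambda>x. 1)"
  by (simp add: trig_def fun_eq_iff)

lemma trig_mult: "trig h x * trig k x = trig (h + k) x"
  by (simp add: trig_def cis_mult ring_distribs)

lemma cnj_trig: "cnj (trig h x) = trig (- h) x"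
  by (simp add: trig_def cis_cnj)

lemma norm_trig [simp]: "cmod (trig h x) = 1"
  by (simp add: trig_def)

lemma continuous_on_trig [continuous_intros]: "continuous_on A (trig h)"
  unfolding trig_def by (intro continuous_intros)

lemma borel_measurable_trig [measurable]: "trig h \<in> borel_measurable borel"
  by (intro borel_measurable_continuous_onI continuous_on_trig)

lemma trig_eq_exp: "trig h x = exp (\<i> * of_int h * of_real x)"
  by (simp add: trig_def cis_conv_exp mult.assoc)

lemma trig_shift: "trig h (x - 2 * pi * of_int n) = trig h x"
proof -
  have "of_int h * (x - 2 * pi * of_int n) = of_int h * x - 2 * pi * of_int (h * n)"
    by (simp add: algebra_simps)
  then show ?thesis
    by (simp add: trig_def cis_divide[symmetric] cis_multiple_2pi del: of_int_mult)
qed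

lemma has_bochner_integral_trig:
  "has_bochner_integral lborel (\<lambda>x. indicator {-pi..pi} x *\<^sub>R trig h x) (if h = 0 then 2 * pi else 0)"
proof (cases "h = 0")
  case True
  have "(complex_of_real has_vector_derivative 1) (at x within {-pi..pi})" for x
    using bounded_linear.has_vector_derivative[OF bounded_linear_of_real has_vector_derivative_id]
    by fastforce
  then show ?thesis
    using has_bochner_integral_FTC_Icc[of "-pi" pi complex_of_real "\<lambda>x. 1"] True
    by (simp add: trig_zero)
next
  case False
  have "trig h pi = trig h (-pi)"
    using trig_shift[of h pi 1] by simp
  moreover have "((\<lambda>x. trig h x / (\<i> * of_int h)) has_vector_derivative trig h x) (at x within {-pi..pi})" for x
    unfolding trig_eq_exp using False
    by (auto intro!: derivative_eq_intros has_vector_derivative_real_field simp: field_simps)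
  ultimately show ?thesis
    using has_bochner_integral_FTC_Icc[of "-pi" pi "\<lambda>x. trig h x / (\<i> * of_int h)" "trig h"] False
    by (simp add: continuous_on_trig)
qed

text \<open>The expected periodogram of a stationary sequence with autocovariance \<open>\<gamma>\<close>. As a Cesaro mean of the
  formal Fourier series of \<open>\<gamma>\<close> it has the Fourier coefficients \<open>(1 - \<bar>h\<bar>/N) \<gamma> h\<close> for \<open>\<bar>h\<bar> \<le> N\<close>; as a
  quadratic form in the vector of the \<open>trig (- j) x\<close> it is non-negative if \<open>\<gamma>\<close> is positive definite. The double sum is real for Hermitian \<open>\<gamma>\<close>, and taking
  the real part makes it a candidate for a density.\<close>

definition periodogram :: "(int \<Rightarrow> complex) \<Rightarrow> nat \<Rightarrow> real \<Rightarrow> real"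
  where "periodogram \<gamma> N x =
    Re (\<Sum>j<N. \<Sum>l<N. trig (- int j) x * cnj (trig (- int l) x) * \<gamma> (int j - int l)) / (2 * pi * N)"

lemma periodogram_complex:
  assumes herm: "\<And>h. \<gamma> (- h) = cnj (\<gamma> h)"
  shows "complex_of_real (periodogram \<gamma> N x) =
    (\<Sum>j<N. \<Sum>l<N. trig (int l - int j) x * \<gamma> (int j - int l)) / (2 * pi * N)"
proof -
  let ?S = "\<Sum>j<N. \<Sum>l<N. trig (int l - int j) x * \<gamma> (int j - int l)"
  have "cnj ?S = (\<Sum>j<N. \<Sum>l<N. trig (int j - int l) x * \<gamma> (int l - int j))"
    by (simp add: cnj_trig herm[symmetric])
  also have "\<dots> = ?S"
    by (rule sum.swap)
  finally have "?S \<in> \<real>"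
    by (simp only: Reals_cnj_iff)
  then have S: "complex_of_real (Re ?S) = ?S"
    by (rule of_real_Re)
  have "periodogram \<gamma> N x = Re ?S / (2 * pi * N)"
    by (simp add: periodogram_def cnj_trig trig_mult)
  then show ?thesis
    using S by simp
qed

lemma continuous_on_periodogram: "continuous_on A (periodogram \<gamma> N)"
  unfolding periodogram_def divide_inverse by (intro continuous_intros)

lemma borel_measurable_periodogram [measurable]: "periodogram \<gamma> N \<in> borel_measurable borel"
  by (intro borel_measurable_continuous_onI continuous_on_periodogram)

text \<open>Among the pairs \<open>(j, l)\<close> with entries below \<open>N\<close>, the lag \<open>h\<close> occurs \<open>N - \<bar>h\<bar>\<close> times; this is the
  Fejer weight of the coefficient \<open>\<gamma> h\<close>.\<close>

lemma sum_lag_indicator: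
  fixes h :: int
  shows "(\<Sum>j<N. \<Sum>l<N. if int j - int l = h then 1 else (0::complex)) = of_nat (N - nat \<bar>h\<bar>)"
proof -
  have "(\<Sum>j<N. \<Sum>l<N. if int j - int l = h then 1 else (0::complex))
      = (\<Sum>l<N. \<Sum>j<N. if j = nat (int l + h) then if 0 \<le> int l + h then 1 else 0 else 0)"
    by (subst sum.swap) (intro sum.cong refl, auto)
  also have "\<dots> = (\<Sum>l<N. if 0 \<le> int l + h \<and> int l + h < int N then 1 else 0)"
    by (auto intro!: sum.cong simp: nat_less_iff)
  also have "\<dots> = of_nat (card {l \<in> {..<N}. 0 \<le> int l + h \<and> int l + h < int N})"
    by (simp add: sum.If_cases Int_def)
  also have "{l \<in> {..<N}. 0 \<le> int l + h \<and> int l + h < int N} = {nat (- h)..<N - nat h}"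
    by auto
  finally show ?thesis
    by (cases "h \<ge> 0") auto
qed

lemma has_bochner_integral_periodogram_trig:
  assumes herm: "\<And>h. \<gamma> (- h) = cnj (\<gamma> h)" and "N > 0"
  shows "has_bochner_integral lborel
    (\<lambda>x. (indicator {-pi..pi} x * periodogram \<gamma> N x) *\<^sub>R trig h x) (of_nat (N - nat \<bar>h\<bar>) / N * \<gamma> h)"
proof -
  have "has_bochner_integral lborel
      (\<lambda>x. \<Sum>j<N. \<Sum>l<N. (indicator {-pi..pi} x *\<^sub>R trig (int l - int j + h) x) * (\<gamma> (int j - int l) / (2 * pi * N)))
      (\<Sum>j<N. \<Sum>l<N. (if int l - int j + h = 0 then 2 * pi else 0) * (\<gamma> (int j - int l) / (2 * pi * N)))"
    by (intro has_bochner_integral_sum has_bochner_integral_mult_left has_bochner_integral_trig)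
  also have "(\<lambda>x. \<Sum>j<N. \<Sum>l<N. (indicator {-pi..pi} x *\<^sub>R trig (int l - int j + h) x) * (\<gamma> (int j - int l) / (2 * pi * N)))
    = (\<lambda>x. (indicator {-pi..pi} x * periodogram \<gamma> N x) *\<^sub>R trig h x)"
    by (simp add: fun_eq_iff scaleR_conv_of_real periodogram_complex[of \<gamma>, OF herm] trig_mult[symmetric]
        sum_distrib_left sum_distrib_right sum_divide_distrib mult_ac)
  also have "(\<Sum>j<N. \<Sum>l<N. (if int l - int j + h = 0 then 2 * pi else 0) * (\<gamma> (int j - int l) / (2 * pi * N)))
    = (\<Sum>j<N. \<Sum>l<N. (if int j - int l = h then 1 else 0)) * \<gamma> h / N"
    unfolding sum_distrib_right sum_divide_distrib by (intro sum.cong refl) auto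
  finally show ?thesis
    unfolding sum_lag_indicator by (simp add: mult.commute)
qed

lemma periodogram_nonneg:
  assumes "\<And>N (c :: nat \<Rightarrow> complex). 0 \<le> Re (\<Sum>j<N. \<Sum>l<N. c j * cnj (c l) * \<gamma> (int j - int l))"
  shows "0 \<le> periodogram \<gamma> N x"
  unfolding periodogram_def by (intro divide_nonneg_nonneg assms) auto

text \<open>Reduction modulo \<open>2\<pi>\<close> to the fundamental domain \<open>(-\<pi>, \<pi>]\<close>.\<close>

definition circle_rep :: "real \<Rightarrow> real"
  where "circle_rep x = x - 2 * pi * of_int \<lceil>(x - pi) / (2 * pi)\<rceil>"

lemma circle_rep_mem: "circle_rep x \<in> {-pi<..pi}"
proof -
  define y z where "y = (x - pi) / (2 * pi)" and "z = of_int \<lceil>y\<rceil> - y"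
  have "x = 2 * pi * y + pi"
    by (simp add: y_def)
  then have "circle_rep x = pi - 2 * pi * z"
    by (simp add: circle_rep_def y_def[symmetric] z_def algebra_simps)
  moreover have "0 \<le> z" "z < 1"
    unfolding z_def by linarith+
  then have "0 \<le> 2 * pi * z" "2 * pi * z < 2 * pi * 1"
    by (intro mult_nonneg_nonneg mult_strict_left_mono; simp)+
  ultimately show ?thesis
    by auto
qed

lemma trig_circle_rep: "trig h (circle_rep x) = trig h x"
  unfolding circle_rep_def by (rule trig_shift)

lemma borel_measurable_circle_rep [measurable]: "circle_rep \<in> borel_measurable borel"
  unfolding circle_rep_def by measurable

lemma char_eq_integral_trig: "char \<mu> (of_int h) = integral\<^sup>L \<mu> (trig h)"
  unfolding char_def by (intro Bochner_Integration.integral_cong) (auto simp: trig_eq_exp mult_ac)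

text \<open>If \<open>\<gamma> 0 > 0\<close>, the normalised periodograms are probability densities on \<open>[-\<pi>, \<pi>]\<close> whose Fourier coefficients
  tend to \<open>\<gamma> h / \<gamma> 0\<close>. By compactness they have a weak limit point, and its Fourier coefficients
  are these limits. A point mass which the limit may have at \<open>-\<pi>\<close> is moved to \<open>\<pi>\<close>.\<close>

theorem Herglotz:
  fixes \<gamma> :: "int \<Rightarrow> complex"
  assumes psd: "\<And>N (c :: nat \<Rightarrow> complex). 0 \<le> Re (\<Sum>j<N. \<Sum>l<N. c j * cnj (c l) * \<gamma> (int j - int l))"
    and herm: "\<And>h. \<gamma> (- h) = cnj (\<gamma> h)"
  obtains \<mu> :: "real measure" where "finite_measure \<mu>" "sets \<mu> = sets borel"
    "AE x in \<mu>. x \<in> {-pi<..pi}" "\<And>h. \<gamma> h = integral\<^sup>L \<mu> (trig h)"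
proof -
  define q where "q N x = indicator {-pi..pi} x * periodogram \<gamma> N x" for N x
  have q_nonneg: "0 \<le> q N x" for N x
    by (simp add: q_def periodogram_nonneg[OF psd])
  have q_meas [measurable]: "q N \<in> borel_measurable borel" for N
    unfolding q_def by measurable
  have q_trig: "has_bochner_integral lborel (\<lambda>x. q N x *\<^sub>R trig h x) (of_nat (N - nat \<bar>h\<bar>) / N * \<gamma> h)"
    if "N > 0" for N h
    unfolding q_def using that by (intro has_bochner_integral_periodogram_trig herm)
  have \<gamma>0: "\<gamma> 0 = complex_of_real (Re (\<gamma> 0))"
    using herm[of 0] by (metis Reals_cnj_iff minus_zero of_real_Re)
  have q_mass: "has_bochner_integral lborel (q N) (Re (\<gamma> 0))" if "N > 0" for N
    using has_bochner_integral_Re[OF q_trig[OF that, of 0]] that by (simp add: trig_zero)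
  have mass_nonneg: "0 \<le> Re (\<gamma> 0)"
  proof -
    have "0 \<le> integral\<^sup>L lborel (q 1)"
      by (intro Bochner_Integration.integral_nonneg q_nonneg)
    then show ?thesis
      using has_bochner_integral_integral_eq[OF q_mass[of 1]] by simp
  qed
  show thesis
    \<comment> \<open>The densities can be normalised only if their total mass \<open>\<gamma> 0\<close> is positive; if it is zero, the
      integral formula bounds every \<open>\<gamma> h\<close> by it.\<close>
  proof (cases "\<gamma> 0 = 0")
    case True
    have "\<gamma> h = 0" for h
    proof -
      define N where "N = Suc (nat \<bar>h\<bar>)"
      have "norm (integral\<^sup>L lborel (\<lambda>x. q N x *\<^sub>R trig h x)) \<le> integral\<^sup>L lborel (\<lambda>x. norm (q N x *\<^sub>R trig h x))"
        by (rule integral_norm_bound)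
      also have "\<dots> = integral\<^sup>L lborel (q N)"
        by (simp add: q_nonneg)
      also have "\<dots> = 0"
        using has_bochner_integral_integral_eq[OF q_mass, of N] True by (simp add: N_def)
      finally have "integral\<^sup>L lborel (\<lambda>x. q N x *\<^sub>R trig h x) = 0"
        by simp
      moreover have "N > 0" "N - nat \<bar>h\<bar> = 1"
        by (simp_all add: N_def)
      ultimately show ?thesis
        using has_bochner_integral_integral_eq[OF q_trig, of N h] by simp
    qed
    then show thesis
      by (intro that[of "null_measure borel"]) (auto intro!: finite_measureI simp: AE_iff_null)
  next
    case False
    define m where "m = Re (\<gamma> 0)"
    have m: "m > 0"
      using False mass_nonneg \<gamma>0 unfolding m_def by (metis of_real_0 order_le_less)
    define P where "P n = density lborel (\<lambda>x. ennreal (q (Suc n) x / m))" for n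
    have emeasure_P: "emeasure (P n) A = ennreal (integral\<^sup>L lborel (\<lambda>x. q (Suc n) x / m))"
      if "{-pi..pi} \<subseteq> A" "A \<in> sets borel" for n A
    proof -
      have "emeasure (P n) A = (\<integral>\<^sup>+ x. ennreal (q (Suc n) x / m) * indicator A x \<partial>lborel)"
        unfolding P_def using that by (subst emeasure_density) auto
      also have "\<dots> = (\<integral>\<^sup>+ x. ennreal (q (Suc n) x / m) \<partial>lborel)"
        using that by (intro nn_integral_cong) (auto simp: q_def indicator_def)
      also have "\<dots> = ennreal (integral\<^sup>L lborel (\<lambda>x. q (Suc n) x / m))"
        using q_mass[of "Suc n"] q_nonneg m
        by (intro nn_integral_eq_integral) (auto simp: has_bochner_integral_iff)
      finally show ?thesis .
    qed
    have mass_P: "emeasure (P n) A = 1" if "{-pi..pi} \<subseteq> A" "A \<in> sets borel" for n A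
      using emeasure_P[OF that] q_mass[of "Suc n"] m by (simp add: has_bochner_integral_iff m_def)
    have prob_P: "prob_space (P n)" for n
      by (rule prob_spaceI) (use mass_P[of UNIV n] in \<open>simp add: P_def\<close>)
    have dist_P: "real_distribution (P n)" for n
      unfolding real_distribution_def real_distribution_axioms_def using prob_P by (simp add: P_def)
    have "tight P"
      unfolding tight_def
    proof (intro conjI allI impI dist_P exI)
      show "-4 < (4::real)"
        by simp
      show "1 - \<epsilon> < measure (P n) {-4<..4}" if "\<epsilon> > 0" for n \<epsilon>
      proof -
        have "{-pi..pi} \<subseteq> {-4<..4}"
          using pi_less_4 by auto
        then show ?thesis
          using mass_P[of "{-4<..4}" n] that by (simp add: measure_def)
      qed
    qed
    then obtain r \<nu> where r: "strict_mono r" and dist_\<nu>: "real_distribution \<nu>"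
      and weak: "weak_conv_m (P \<circ> id \<circ> r) \<nu>"
      using tight_imp_convergent_subsubsequence[OF _ strict_mono_id] by blast
    interpret \<nu>: real_distribution \<nu>
      by (rule dist_\<nu>)
    have char_P: "char (P n) (of_int h) = of_nat (Suc n - nat \<bar>h\<bar>) / of_nat (Suc n) * (\<gamma> h / m)" for n h
    proof -
      have "char (P n) (of_int h) = integral\<^sup>L lborel (\<lambda>x. (q (Suc n) x / m) *\<^sub>R trig h x)"
        unfolding char_eq_integral_trig P_def using q_nonneg m
        by (intro integral_density) auto
      also have "\<dots> = integral\<^sup>L lborel (\<lambda>x. (q (Suc n) x *\<^sub>R trig h x) / m)"
        by (simp add: scaleR_conv_of_real)
      also have "\<dots> = of_nat (Suc n - nat \<bar>h\<bar>) / of_nat (Suc n) * \<gamma> h / m"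
        using has_bochner_integral_integral_eq[OF q_trig, of "Suc n" h] by simp
      finally show ?thesis
        by simp
    qed
    have char_\<nu>: "char \<nu> (of_int h) = \<gamma> h / m" for h
    proof (rule LIMSEQ_unique)
      have "(\<lambda>n. char ((P \<circ> id \<circ> r) n) (of_int h)) \<longlonglongrightarrow> char \<nu> (of_int h)"
        by (rule levy_continuity1[OF _ dist_\<nu> weak]) (simp add: dist_P)
      then show "(\<lambda>n. char (P (r n)) (of_int h)) \<longlonglongrightarrow> char \<nu> (of_int h)"
        by simp
      have "(\<lambda>n. real (Suc n - nat \<bar>h\<bar>) / real (Suc n)) \<longlonglongrightarrow> 1"
      proof (rule Lim_transform_eventually)
        show "(\<lambda>n. 1 - real (nat \<bar>h\<bar>) * inverse (real (Suc n))) \<longlonglongrightarrow> 1"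
          using tendsto_diff[OF tendsto_const tendsto_mult[OF tendsto_const LIMSEQ_inverse_real_of_nat]]
          by fastforce
        show "\<forall>\<^sub>F n in sequentially. 1 - real (nat \<bar>h\<bar>) * inverse (real (Suc n))
            = real (Suc n - nat \<bar>h\<bar>) / real (Suc n)"
          using eventually_ge_at_top[of "nat \<bar>h\<bar>"]
          by eventually_elim (simp add: of_nat_diff field_simps)
      qed
      then have "(\<lambda>n. complex_of_real (real (Suc n - nat \<bar>h\<bar>) / real (Suc n)) * (\<gamma> h / m)) \<longlonglongrightarrow> complex_of_real 1 * (\<gamma> h / m)"
        by (intro tendsto_intros)
      then have "(\<lambda>n. char (P n) (of_int h)) \<longlonglongrightarrow> \<gamma> h / m"
        by (simp add: char_P)
      from LIMSEQ_subseq_LIMSEQ[OF this r] show "(\<lambda>n. char (P (r n)) (of_int h)) \<longlonglongrightarrow> \<gamma> h / m"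
        by (simp add: o_def)
    qed
    define \<mu> where "\<mu> = density (distr \<nu> borel circle_rep) (\<lambda>_. ennreal m)"
    have sets_\<mu>: "sets \<mu> = sets borel"
      by (simp add: \<mu>_def)
    show thesis
    proof (rule that[of \<mu>])
      have "emeasure (distr \<nu> borel circle_rep) UNIV = 1"
        using \<nu>.emeasure_space_1 by (subst emeasure_distr) (auto simp: \<nu>.space_eq_univ)
      then show "finite_measure \<mu>"
        by (intro finite_measureI) (simp add: \<mu>_def emeasure_density)
      show "AE x in \<mu>. x \<in> {-pi<..pi}"
        unfolding \<mu>_def by (subst AE_density, simp, subst AE_distr_iff) (auto simp: circle_rep_mem[simplified])
      show "\<gamma> h = integral\<^sup>L \<mu> (trig h)" for h
      proof -
        have "integral\<^sup>L \<mu> (trig h) = m * integral\<^sup>L \<nu> (\<lambda>x. trig h (circle_rep x))"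
          unfolding \<mu>_def using m by (subst integral_density) (auto simp: integral_distr scaleR_conv_of_real)
        also have "\<dots> = m * char \<nu> (of_int h)"
          by (simp add: trig_circle_rep char_eq_integral_trig)
        finally show ?thesis
          using m by (simp add: char_\<nu>)
      qed
    qed (rule sets_\<mu>)
  qed
qed

section \<open>Trigonometric approximation of indicators of arcs\<close>

inductive trig_poly :: "(real \<Rightarrow> complex) \<Rightarrow> bool" where
  base: "trig_poly (trig t)"
| add: "trig_poly \<phi> \<Longrightarrow> trig_poly \<psi> \<Longrightarrow> trig_poly (\<lambda>x. \<phi> x + \<psi> x)"
| scale: "trig_poly \<phi> \<Longrightarrow> trig_poly (\<lambda>x. c * \<phi> x)"

lemma trig_poly_const: "trig_poly (\<lambda>x. c)"
  using trig_poly.scale[OF trig_poly.base[of 0], of c] by (simp add: trig_zero)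

lemma trig_poly_mult:
  assumes "trig_poly \<phi>" "trig_poly \<psi>"
  shows "trig_poly (\<lambda>x. \<phi> x * \<psi> x)"
proof -
  have shift: "trig_poly (\<lambda>x. trig t x * \<psi> x)" for t
    using assms(2)
  proof induction
    case (base s)
    show ?case
      using trig_poly.base[of "t + s"] by (simp add: trig_mult)
  next
    case (add \<phi> \<psi>)
    then show ?case
      using trig_poly.add by (simp add: ring_distribs)
  next
    case (scale \<phi> c)
    then show ?case
      using trig_poly.scale[of "\<lambda>x. trig t x * \<phi> x" c] by (simp add: mult_ac)
  qed
  show ?thesis
    using assms(1)
  proof induction
    case (add \<phi> \<psi>)
    then show ?case
      using trig_poly.add by (simp add: ring_distribs)
  next
    case (scale \<phi> c)
    then show ?case
      using trig_poly.scale[of "\<lambda>x. \<phi> x * \<psi> x" c] by (simp add: mult_ac)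
  qed (rule shift)
qed

text \<open>Stone--Weierstrass on the unit circle: pulled back along \<open>cis\<close>, trigonometric polynomials form an
  algebra, and the real and imaginary parts separate points.\<close>

lemma trig_poly_dense:
  fixes f :: "complex \<Rightarrow> real"
  assumes "continuous_on (sphere 0 1) f" "e > 0"
  obtains p where "trig_poly (\<lambda>x. complex_of_real (p x))" "\<And>x. \<bar>f (cis x) - p x\<bar> < e"
proof -
  define P where "P g \<longleftrightarrow> continuous_on (sphere 0 1) g \<and> trig_poly (\<lambda>x. complex_of_real (g (cis x)))"
    for g :: "complex \<Rightarrow> real"
  have "(\<lambda>x. 1 / 2 * trig 1 x + 1 / 2 * trig (- 1) x) = (\<lambda>x. complex_of_real (Re (cis x)))"
    by (auto simp: fun_eq_iff trig_def complex_eq_iff)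
  moreover have "trig_poly (\<lambda>x. 1 / 2 * trig 1 x + 1 / 2 * trig (- 1) x)"
    by (intro trig_poly.intros)
  ultimately have "trig_poly (\<lambda>x. complex_of_real (Re (cis x)))"
    by (simp only:)
  then have P_Re: "P Re"
    unfolding P_def by (intro conjI continuous_intros)
  have "(\<lambda>x. - \<i> / 2 * trig 1 x + \<i> / 2 * trig (- 1) x) = (\<lambda>x. complex_of_real (Im (cis x)))"
    by (auto simp: fun_eq_iff trig_def complex_eq_iff)
  moreover have "trig_poly (\<lambda>x. - \<i> / 2 * trig 1 x + \<i> / 2 * trig (- 1) x)"
    by (intro trig_poly.intros)
  ultimately have "trig_poly (\<lambda>x. complex_of_real (Im (cis x)))"
    by (simp only:)
  then have P_Im: "P Im"
    unfolding P_def by (intro conjI continuous_intros)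
  have "\<exists>g. P g \<and> (\<forall>x\<in>sphere 0 1. \<bar>f x - g x\<bar> < e)"
  proof (rule Stone_Weierstrass_HOL[OF _ _ _ _ _ _ assms])
    fix x y :: complex
    assume "x \<in> sphere 0 1 \<and> y \<in> sphere 0 1 \<and> x \<noteq> y"
    then have "Re x \<noteq> Re y \<or> Im x \<noteq> Im y"
      by (auto simp: complex_eq_iff)
    then show "\<exists>g. P g \<and> g x \<noteq> g y"
      using P_Re P_Im by blast
  qed (auto simp: P_def intro!: continuous_intros trig_poly_const trig_poly.add trig_poly_mult)
  then obtain g where "P g" "\<forall>x\<in>sphere 0 1. \<bar>f x - g x\<bar> < e"
    by blast
  then show thesis
    by (intro that[of "\<lambda>x. g (cis x)"]) (auto simp: P_def)
qed

lemma cis_eq_imp_eq: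
  assumes "cis x = cis y" "x \<in> {-pi<..<pi}" "y \<in> {-pi..<pi}"
  shows "x = y"
proof -
  have "sin x = sin y \<and> cos x = cos y"
    using assms(1) by (metis cis.simps)
  then obtain n :: int where n: "x = y + 2 * pi * n"
    using sin_cos_eq_iff by blast
  have "2 * pi * of_int n < 2 * pi * 1" "2 * pi * (- 1) < 2 * pi * of_int n"
    using assms(2,3) n unfolding greaterThanLessThan_iff atLeastLessThan_iff by linarith+
  then have "real_of_int n < 1" "- 1 < real_of_int n"
    using mult_left_less_imp_less[of "2 * pi"] pi_ge_zero by (force simp only: mult_nonneg_nonneg zero_le_numeral)+
  then have "n = 0"
    by linarith
  with n show ?thesis
    by simp
qed

text \<open>On the circle the arc \<open>(-\<pi>, a]\<close> is the closed arc \<open>K = [-\<pi>, a]\<close> without the point \<open>-1\<close>. The first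
  factor of \<open>G n\<close> below tends to the indicator of \<open>K\<close>, the second one to that of the complement of
  \<open>-1\<close>. As \<open>G n\<close> is continuous on the circle, a trigonometric polynomial is uniformly close to it.\<close>

lemma trig_poly_approximates_arc:
  assumes a: "a \<in> {-pi..<pi}"
  obtains \<phi> where "\<And>n. trig_poly (\<phi> n)" "\<And>n x. cmod (\<phi> n x) \<le> 2"
    "\<And>x. x \<in> {-pi<..pi} \<Longrightarrow> (\<lambda>n :: nat. \<phi> n x) \<longlonglongrightarrow> indicator {..a} x"
proof -
  define K where "K = cis ` {-pi..a}"
  have K: "closed K" "K \<noteq> {}"
    using a unfolding K_def
    by (auto intro!: compact_imp_closed compact_continuous_image continuous_intros)
  define G where "G n z = max 0 (1 - real n * infdist z K) * min 1 (real n * cmod (z + 1))" for n z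
  have G_cont: "continuous_on A (G n)" for n A
    unfolding G_def by (intro continuous_intros)
  have G_bounds: "0 \<le> G n z" "G n z \<le> 1" for n z
  proof -
    show "0 \<le> G n z"
      by (simp add: G_def)
    have "G n z \<le> 1 * 1"
      unfolding G_def by (intro mult_mono) (auto simp: infdist_nonneg)
    then show "G n z \<le> 1"
      by simp
  qed
  have "\<exists>p. trig_poly (\<lambda>x. complex_of_real (p x)) \<and> (\<forall>x. \<bar>G n (cis x) - p x\<bar> < inverse (real (Suc n)))" for n
    by (rule trig_poly_dense[OF G_cont]) auto
  then obtain p where p: "trig_poly (\<lambda>x. complex_of_real (p n x))"
    "\<bar>G n (cis x) - p n x\<bar> < inverse (real (Suc n))" for n x
    by metis
  have p_bound: "\<bar>p n x\<bar> \<le> 2" for n x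
  proof -
    have "inverse (real (Suc n)) \<le> 1"
      by (simp add: field_simps)
    then show ?thesis
      using p(2)[of n x] G_bounds[of n "cis x"] by linarith
  qed
  have eventually_ge: "\<forall>\<^sub>F n in sequentially. 1 \<le> real n * c" if "c > 0" for c
  proof -
    obtain N where "real N > 1 / c"
      using reals_Archimedean2 by blast
    then have "1 \<le> real n * c" if "n \<ge> N" for n
    proof -
      have "1 / c \<le> real n"
        using \<open>real N > 1 / c\<close> that by linarith
      then show ?thesis
        using \<open>c > 0\<close> by (simp add: field_simps)
    qed
    then show ?thesis
      using eventually_sequentially by blast
  qed
  have G_lim: "(\<lambda>n. G n (cis x)) \<longlonglongrightarrow> indicator {..a} x" if x: "x \<in> {-pi<..pi}" for x
  proof -
    consider "x = pi" | "x < pi" "x \<le> a" | "x < pi" "a < x"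
      using x by force
    then have "\<forall>\<^sub>F n in sequentially. G n (cis x) = indicator {..a} x"
    proof cases
      case 1
      then show ?thesis
        using a by (simp add: G_def)
    next
      case 2
      have "cis x \<noteq> cis (-pi)"
        using cis_eq_imp_eq[of x "-pi"] x 2 by auto
      then have "cmod (cis x + 1) > 0"
        by (simp add: add_eq_0_iff2 cis_conv_exp exp_minus)
      moreover have "cis x \<in> K"
        using 2 x by (auto simp: K_def)
      ultimately show ?thesis
        using eventually_ge[of "cmod (cis x + 1)"] 2 by (auto simp: G_def elim!: eventually_mono)
    next
      case 3
      have "cis x \<notin> K"
        using cis_eq_imp_eq[of x] 3 x a by (force simp: K_def)
      then have "infdist (cis x) K > 0"
        using K by (simp add: infdist_pos_not_in_closed)
      then show ?thesis
        using eventually_ge[of "infdist (cis x) K"] 3 by (auto simp: G_def elim!: eventually_mono)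
    qed
    then show ?thesis
      by (rule tendsto_eventually)
  qed
  have lim: "(\<lambda>n. p n x) \<longlonglongrightarrow> indicator {..a} x" if x: "x \<in> {-pi<..pi}" for x
  proof -
    have "(\<lambda>n. G n (cis x) - p n x) \<longlonglongrightarrow> 0"
      by (rule Lim_null_comparison[OF _ LIMSEQ_inverse_real_of_nat])
        (use p(2) in \<open>auto intro!: always_eventually less_imp_le\<close>)
    from tendsto_diff[OF G_lim[OF x] this] show ?thesis
      by simp
  qed
  show thesis
  proof (rule that[of "\<lambda>n x. complex_of_real (p n x)"])
    fix x assume "x \<in> {-pi<..pi}"
    from tendsto_of_real[OF lim[OF this]]
    show "(\<lambda>n. complex_of_real (p n x)) \<longlonglongrightarrow> indicator {..a} x"
      by (cases "x \<le> a") simp_all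
  qed (use p p_bound in auto)
qed

section \<open>The spectral correspondence\<close>

text \<open>The relation \<open>spectral M X \<phi> Y\<close> expresses \<open>Y = \<integral> \<phi> dZ\<close> before the process \<open>Z\<close> is available: it is the
  graph, up to almost sure equality, of the map that sends \<open>trig t\<close> to \<open>X t\<close>, extended linearly and along bounded pointwise limits.
  Bounded pointwise convergence refers to no measure. The same relation can therefore be compared with
  the spectral measure of \<open>X\<close> and with the spectral measures of all coordinate processes of \<open>X\<close>. Values
  of \<open>\<phi>\<close> outside \<open>(-\<pi>, \<pi>]\<close> are constrained by measurability alone.\<close>

inductive spectral ::
  "'o measure \<Rightarrow> (int \<Rightarrow> 'o \<Rightarrow> 'h::{complex_inner, banach, second_countable_topology})
    \<Rightarrow> (real \<Rightarrow> complex) \<Rightarrow> ('o \<Rightarrow> 'h) \<Rightarrow> bool"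
  for M X where
  base: "spectral M X (trig t) (X t)"
| add: "spectral M X \<phi> Y \<Longrightarrow> spectral M X \<psi> W \<Longrightarrow> spectral M X (\<lambda>x. \<phi> x + \<psi> x) (\<lambda>w. Y w + W w)"
| scale: "spectral M X \<phi> Y \<Longrightarrow> spectral M X (\<lambda>x. c * \<phi> x) (\<lambda>w. c *\<^sub>C Y w)"
| limit: "(\<And>n. spectral M X (\<phi> n) (Y n)) \<Longrightarrow> (\<And>n x. x \<in> {-pi<..pi} \<Longrightarrow> cmod (\<phi> n x) \<le> B) \<Longrightarrow>
    (\<And>x. x \<in> {-pi<..pi} \<Longrightarrow> (\<lambda>n. \<phi> n x) \<longlonglongrightarrow> \<psi> x) \<Longrightarrow> \<psi> \<in> borel_measurable borel \<Longrightarrow>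
    W \<in> L2_elements M \<Longrightarrow> (\<lambda>n. L2_norm M (\<lambda>w. Y n w - W w)) \<longlonglongrightarrow> 0 \<Longrightarrow> spectral M X \<psi> W"

lemma spectral_diff:
  assumes "spectral M X \<phi> Y" "spectral M X \<psi> W"
  shows "spectral M X (\<lambda>x. \<phi> x - \<psi> x) (\<lambda>w. Y w - W w)"
  using spectral.add[OF assms(1) spectral.scale[OF assms(2), of "-1"]] by (simp add: scaleC_minus_one)

lemma spectral_zero: "spectral M X (\<lambda>x. 0) (\<lambda>w. 0)"
  using spectral.scale[OF spectral.base[of M X 0], of 0] by simp

lemma spectral_sum:
  assumes "\<And>i. i \<in> I \<Longrightarrow> spectral M X (\<phi> i) (Y i)"
  shows "spectral M X (\<lambda>x. \<Sum>i\<in>I. \<phi> i x) (\<lambda>w. \<Sum>i\<in>I. Y i w)"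
  using assms
  by (induction I rule: infinite_finite_induct) (auto simp: spectral_zero intro: spectral.add)

lemma trig_poly_spectral: "trig_poly \<phi> \<Longrightarrow> \<exists>Y. spectral M X \<phi> Y"
  by (induction rule: trig_poly.induct) (blast intro: spectral.intros)+

lemma spectral_measurable: "spectral M X \<phi> Y \<Longrightarrow> \<phi> \<in> borel_measurable borel"
  by (induction rule: spectral.induct) auto

lemma spectral_bounded: "spectral M X \<phi> Y \<Longrightarrow> \<exists>B. \<forall>x\<in>{-pi<..pi}. cmod (\<phi> x) \<le> B"
proof (induction rule: spectral.induct)
  case (base t)
  then show ?case
    by (auto intro!: exI[of _ 1])
next
  case (add \<phi> Y \<psi> W)
  then show ?case
    by (meson norm_add_leD norm_triangle_mono)
next
  case (scale \<phi> Y c)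
  then obtain B where "\<forall>x\<in>{-pi<..pi}. cmod (\<phi> x) \<le> B"
    by blast
  then show ?case
    by (intro exI[of _ "cmod c * B"]) (auto simp: norm_mult intro: mult_left_mono)
next
  case (limit \<phi> Y B \<psi> W)
  then have "cmod (\<psi> x) \<le> B" if "x \<in> {-pi<..pi}" for x
    using that by (intro Lim_bounded[OF tendsto_norm[OF limit.hyps(3)], of _ 0]) auto
  then show ?case
    by blast
qed

lemma spectral_L2:
  assumes "spectral M X \<phi> Y" "\<And>t. X t \<in> L2_elements M"
  shows "Y \<in> L2_elements M"
  using assms by (induction rule: spectral.induct) auto

lemma (in prob_space) spectral_zero_mean:
  assumes "spectral M X \<phi> Y" "\<And>t. X t \<in> L2_elements M" "\<And>t. integral\<^sup>L M (X t) = 0"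
  shows "integral\<^sup>L M Y = 0"
  using assms(1)
proof (induction rule: spectral.induct)
  case (base t)
  then show ?case
    by (rule assms)
next
  case (add \<phi> Y \<psi> W)
  then show ?case
    using spectral_L2[OF _ assms(2)] by (simp add: L2_integrable)
next
  case (scale \<phi> Y c)
  have "integral\<^sup>L M (\<lambda>w. c *\<^sub>C Y w) = c *\<^sub>C integral\<^sup>L M Y"
    using spectral_L2[OF scale.hyps assms(2)]
    by (intro integral_bounded_linear scaleC.bounded_linear_right L2_integrable)
  then show ?case
    by (simp add: scale scaleC.zero_right)
next
  case (limit \<phi> Y B \<psi> W)
  have Y: "Y n \<in> L2_elements M" for n
    by (rule spectral_L2[OF limit.hyps(1) assms(2)])
  have "norm (integral\<^sup>L M W) \<le> L2_norm M (\<lambda>w. Y n w - W w)" for n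
  proof -
    have "norm (integral\<^sup>L M W) = norm (integral\<^sup>L M (\<lambda>w. Y n w - W w))"
      using limit.IH Y limit.hyps by (simp add: L2_integrable)
    also have "\<dots> \<le> integral\<^sup>L M (\<lambda>w. norm (Y n w - W w))"
      by (rule integral_norm_bound)
    also have "\<dots> \<le> L2_norm M (\<lambda>w. Y n w - W w)"
      by (intro L2_integral_norm_le L2_elements_diff Y limit.hyps)
    finally show ?thesis .
  qed
  then have "norm (integral\<^sup>L M W) \<le> 0"
    using limit.hyps by (intro LIMSEQ_le_const[of _ 0]) auto
  then show ?case
    by simp
qed

lemma norm_cinner_square_le: "(cmod (cinner x y))\<^sup>2 \<le> (norm x)\<^sup>2 * (norm y)\<^sup>2"
  using power_mono[OF norm_cinner_le norm_ge_zero, of x y 2] by (simp add: power_mult_distrib)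

lemma L2_elements_cinner:
  assumes "Y \<in> L2_elements M"
  shows "(\<lambda>w. cinner (Y w) g) \<in> L2_elements M"
proof (rule L2_elementsI)
  note [measurable] = L2_elements_measurable[OF assms]
  show "(\<lambda>w. cinner (Y w) g) \<in> borel_measurable M"
    by measurable
  show "integrable M (\<lambda>w. (cmod (cinner (Y w) g))\<^sup>2)"
    by (rule Bochner_Integration.integrable_bound[where f = "\<lambda>w. (norm (Y w))\<^sup>2 * (norm g)\<^sup>2"])
      (use assms in \<open>auto intro!: L2_elements_integrable integrable_mult_left AE_I2 norm_cinner_square_le\<close>)
qed

lemma L2_norm_cinner_le:
  assumes "Y \<in> L2_elements M"
  shows "L2_norm M (\<lambda>w. cinner (Y w) g) \<le> L2_norm M Y * norm g"
proof (rule power2_le_imp_le)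
  have "(L2_norm M (\<lambda>w. cinner (Y w) g))\<^sup>2 \<le> integral\<^sup>L M (\<lambda>w. (norm (Y w))\<^sup>2 * (norm g)\<^sup>2)"
    unfolding L2_norm_square
    by (intro integral_mono L2_elements_integrable L2_elements_cinner integrable_mult_left
        norm_cinner_square_le assms)
  then show "(L2_norm M (\<lambda>w. cinner (Y w) g))\<^sup>2 \<le> (L2_norm M Y * norm g)\<^sup>2"
    by (simp add: L2_norm_square power_mult_distrib)
qed simp

text \<open>Taking coordinates is linear and continuous, so it commutes with the correspondence.\<close>

lemma spectral_cinner:
  assumes "spectral M X \<phi> Y" "\<And>t. X t \<in> L2_elements M"
  shows "spectral M (\<lambda>t w. cinner (X t w) g) \<phi> (\<lambda>w. cinner (Y w) g)"
  using assms(1)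
proof (induction rule: spectral.induct)
  case (base t)
  then show ?case
    by (rule spectral.base)
next
  case (add \<phi> Y \<psi> W)
  then show ?case
    by (auto simp: cinner_add_left intro: spectral.add)
next
  case (scale \<phi> Y c)
  then show ?case
    using spectral.scale[OF scale.IH, of c] by (simp add: cinner_scaleC_left scaleC_complex_def)
next
  case (limit \<phi> Y B \<psi> W)
  show ?case
  proof (rule spectral.limit[OF limit.IH limit.hyps(2-4)])
    show "(\<lambda>w. cinner (W w) g) \<in> L2_elements M"
      by (rule L2_elements_cinner[OF limit.hyps(5)])
    show "(\<lambda>n. L2_norm M (\<lambda>w. cinner (Y n w) g - cinner (W w) g)) \<longlonglongrightarrow> 0"
    proof (rule Lim_null_comparison)
      show "\<forall>\<^sub>F n in sequentially. norm (L2_norm M (\<lambda>w. cinner (Y n w) g - cinner (W w) g))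
          \<le> L2_norm M (\<lambda>w. Y n w - W w) * norm g"
        using L2_norm_cinner_le[OF L2_elements_diff[OF spectral_L2[OF limit.hyps(1) assms(2)] limit.hyps(5)]]
        by (intro always_eventually) (simp add: cinner.diff_left)
      show "(\<lambda>n. L2_norm M (\<lambda>w. Y n w - W w) * norm g) \<longlonglongrightarrow> 0"
        using tendsto_mult_right[OF limit.hyps(6), of "norm g"] by simp
    qed
  qed auto
qed

section \<open>The isometry between the frequency and the time domain\<close>

lemma borel_measurable_cnj [measurable (raw)]:
  "f \<in> borel_measurable M \<Longrightarrow> (\<lambda>x. cnj (f x)) \<in> borel_measurable M"
  by (rule measurable_compose[OF _ borel_measurable_continuous_onI[OF continuous_on_cnj[OF continuous_on_id]]])

text \<open>The measure is concentrated on the half-open interval, so that the frequencies \<open>-\<pi>\<close> and \<open>\<pi>\<close>, which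
  \<open>trig\<close> cannot distinguish, are represented by \<open>\<pi>\<close> alone.\<close>

locale spectral_measure =
  fixes M :: "'o measure" and X :: "int \<Rightarrow> 'o \<Rightarrow> 'h::{complex_inner, banach, second_countable_topology}"
    and \<mu> :: "real measure"
  assumes process_L2: "X t \<in> L2_elements M"
    and finite_spectral_measure: "finite_measure \<mu>"
    and sets_spectral_measure: "sets \<mu> = sets borel"
    and support: "AE x in \<mu>. x \<in> {-pi<..pi}"
    and covariance: "L2_inner M (X t) (X s) = integral\<^sup>L \<mu> (trig (t - s))"
begin

lemma measurable_spectral_measure: "f \<in> borel_measurable borel \<Longrightarrow> f \<in> borel_measurable \<mu>"
  using measurable_cong_sets[OF sets_spectral_measure refl] by blast

lemma integrable_bounded:
  assumes "f \<in> borel_measurable borel" "\<And>x. x \<in> {-pi<..pi} \<Longrightarrow> cmod (f x) \<le> B"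
  shows "integrable \<mu> f"
  using support assms(2)
  by (intro finite_measure.integrable_const_bound[OF finite_spectral_measure, where B = B]
      measurable_spectral_measure assms(1)) auto

lemma integral_bounded_convergence:
  fixes f :: "nat \<Rightarrow> real \<Rightarrow> complex"
  assumes "\<And>n. f n \<in> borel_measurable borel" "g \<in> borel_measurable borel"
    and "\<And>n x. x \<in> {-pi<..pi} \<Longrightarrow> cmod (f n x) \<le> B"
    and "\<And>x. x \<in> {-pi<..pi} \<Longrightarrow> (\<lambda>n. f n x) \<longlonglongrightarrow> g x"
  shows "(\<lambda>n. integral\<^sup>L \<mu> (f n)) \<longlonglongrightarrow> integral\<^sup>L \<mu> g"
proof (rule integral_dominated_convergence[where w = "\<lambda>_. B"])
  show "integrable \<mu> (\<lambda>_. B)"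
    using finite_spectral_measure by (simp add: finite_measure.integrable_const)
  show "AE x in \<mu>. (\<lambda>n. f n x) \<longlonglongrightarrow> g x"
    using support by eventually_elim (rule assms)
  show "AE x in \<mu>. cmod (f n x) \<le> B" for n
    using support by eventually_elim (rule assms)
qed (intro measurable_spectral_measure assms)+

text \<open>Both sides are linear and continuous in the first argument, so it is enough to know the
  identity for the generators.\<close>

lemma spectral_inner_extend:
  assumes "spectral M X \<phi> Y" and V: "V \<in> L2_elements M"
    and \<eta>: "\<eta> \<in> borel_measurable borel" "\<And>x. x \<in> {-pi<..pi} \<Longrightarrow> cmod (\<eta> x) \<le> C"
    and base: "\<And>t. L2_inner M (X t) V = (\<integral>x. trig t x * cnj (\<eta> x) \<partial>\<mu>)"
  shows "L2_inner M Y V = (\<integral>x. \<phi> x * cnj (\<eta> x) \<partial>\<mu>)"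
  using assms(1)
proof (induction rule: spectral.induct)
  case (base t)
  then show ?case
    by (rule assms)
next
  case (add \<phi> Y \<psi> W)
  have int: "integrable \<mu> (\<lambda>x. \<zeta> x * cnj (\<eta> x))" if U: "spectral M X \<zeta> U" for \<zeta> U
  proof -
    obtain B where "\<forall>x\<in>{-pi<..pi}. cmod (\<zeta> x) \<le> B"
      using spectral_bounded[OF U] by blast
    then have "cmod (\<zeta> x * cnj (\<eta> x)) \<le> B * C" if "x \<in> {-pi<..pi}" for x
      using \<eta>(2)[OF that] that
      by (auto simp: norm_mult intro!: mult_mono intro: order_trans[OF norm_ge_zero])
    moreover have "(\<lambda>x. \<zeta> x * cnj (\<eta> x)) \<in> borel_measurable borel"
      using spectral_measurable[OF U] \<eta>(1) by measurable
    ultimately show ?thesis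
      by (rule integrable_bounded[rotated])
  qed
  then show ?case
    using add spectral_L2[OF _ process_L2] V
    by (simp add: L2_inner_add_left ring_distribs)
next
  case (scale \<phi> Y c)
  then show ?case
    by (simp add: L2_inner_scaleC_left mult.assoc)
next
  case (limit \<phi> Y B \<psi> W)
  show ?case
  proof (rule LIMSEQ_unique)
    show "(\<lambda>n. L2_inner M (Y n) V) \<longlonglongrightarrow> L2_inner M W V"
      using spectral_L2[OF limit.hyps(1) process_L2] limit.hyps V by (intro L2_inner_tendsto_left)
    have "(\<lambda>n. \<integral>x. \<phi> n x * cnj (\<eta> x) \<partial>\<mu>) \<longlonglongrightarrow> (\<integral>x. \<psi> x * cnj (\<eta> x) \<partial>\<mu>)"
    proof (rule integral_bounded_convergence[where B = "B * C"])
      show "(\<lambda>x. \<phi> n x * cnj (\<eta> x)) \<in> borel_measurable borel" for n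
        using spectral_measurable[OF limit.hyps(1)] \<eta>(1) by measurable
      show "(\<lambda>x. \<psi> x * cnj (\<eta> x)) \<in> borel_measurable borel"
        using limit.hyps(4) \<eta>(1) by measurable
      show "cmod (\<phi> n x * cnj (\<eta> x)) \<le> B * C" if "x \<in> {-pi<..pi}" for n x
        using limit.hyps(2)[OF that, of n] \<eta>(2)[OF that]
        by (auto simp: norm_mult intro!: mult_mono intro: order_trans[OF norm_ge_zero])
      show "(\<lambda>n. \<phi> n x * cnj (\<eta> x)) \<longlonglongrightarrow> \<psi> x * cnj (\<eta> x)" if "x \<in> {-pi<..pi}" for x
        by (intro tendsto_intros limit.hyps that)
    qed
    then show "(\<lambda>n. L2_inner M (Y n) V) \<longlonglongrightarrow> (\<integral>x. \<psi> x * cnj (\<eta> x) \<partial>\<mu>)"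
      by (simp add: limit.IH)
  qed
qed

text \<open>The extension principle is applied twice: first with \<open>V = X s\<close>, and, after exchanging the roles of the
  arguments by conjugation, with \<open>V = W\<close>.\<close>

theorem spectral_isometry:
  assumes "spectral M X \<phi> Y" "spectral M X \<psi> W"
  shows "L2_inner M Y W = (\<integral>x. \<phi> x * cnj (\<psi> x) \<partial>\<mu>)"
proof -
  obtain C where C: "\<And>x. x \<in> {-pi<..pi} \<Longrightarrow> cmod (\<psi> x) \<le> C"
    using spectral_bounded[OF assms(2)] by blast
  have "L2_inner M W (X s) = (\<integral>x. \<psi> x * cnj (trig s x) \<partial>\<mu>)" for s
    by (rule spectral_inner_extend[OF assms(2) process_L2 _ _, where C = 1])
      (auto simp: cnj_trig trig_mult covariance)
  then have XW: "L2_inner M (X s) W = cnj (\<integral>x. \<psi> x * cnj (trig s x) \<partial>\<mu>)" for s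
    by (metis L2_inner_commute)
  have XW': "L2_inner M (X s) W = (\<integral>x. trig s x * cnj (\<psi> x) \<partial>\<mu>)" for s
  proof -
    have "cnj (\<integral>x. \<psi> x * cnj (trig s x) \<partial>\<mu>) = (\<integral>x. cnj (\<psi> x * cnj (trig s x)) \<partial>\<mu>)"
      by (rule Bochner_Integration.integral_cnj[symmetric])
    then show ?thesis
      by (simp add: XW mult.commute)
  qed
  show ?thesis
    by (rule spectral_inner_extend[OF assms(1) spectral_L2[OF assms(2) process_L2]
          spectral_measurable[OF assms(2)] C XW'])
qed

lemma spectral_norm:
  assumes "spectral M X \<phi> Y"
  shows "(L2_norm M Y)\<^sup>2 = (\<integral>x. (cmod (\<phi> x))\<^sup>2 \<partial>\<mu>)"
proof -
  have "complex_of_real ((L2_norm M Y)\<^sup>2) = (\<integral>x. complex_of_real ((cmod (\<phi> x))\<^sup>2) \<partial>\<mu>)"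
    by (simp only: L2_inner_self[symmetric] spectral_isometry[OF assms assms] complex_norm_square)
  then show ?thesis
    by (simp only: integral_complex_of_real of_real_eq_iff)
qed

text \<open>The elements corresponding to a bounded pointwise convergent sequence form a Cauchy sequence by the
  isometry, hence converge by completeness.\<close>

lemma spectral_limit_exists:
  assumes "prob_space M"
    and \<phi>: "\<And>n :: nat. \<exists>Y. spectral M X (\<phi> n) Y"
    and bound: "\<And>n x. x \<in> {-pi<..pi} \<Longrightarrow> cmod (\<phi> n x) \<le> B"
    and lim: "\<And>x. x \<in> {-pi<..pi} \<Longrightarrow> (\<lambda>n. \<phi> n x) \<longlonglongrightarrow> \<psi> x"
    and \<psi>: "\<psi> \<in> borel_measurable borel"
  obtains W where "spectral M X \<psi> W"
proof -
  interpret prob_space M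
    by fact
  obtain Y where Y: "spectral M X (\<phi> n) (Y n)" for n
    using \<phi> by metis
  have \<phi>_meas: "\<phi> n \<in> borel_measurable borel" for n
    by (rule spectral_measurable[OF Y])
  have \<psi>_bound: "cmod (\<psi> x) \<le> B" if "x \<in> {-pi<..pi}" for x
    using bound that by (intro Lim_bounded[OF tendsto_norm[OF lim], of _ 0]) auto
  define d where "d n x = complex_of_real ((cmod (\<phi> n x - \<psi> x))\<^sup>2)" for n x
  have d_meas: "d n \<in> borel_measurable borel" for n
    unfolding d_def using \<phi>_meas \<psi> by measurable
  have d_bound: "cmod (d n x) \<le> (2 * B)\<^sup>2" if "x \<in> {-pi<..pi}" for n x
  proof -
    have "cmod (\<phi> n x - \<psi> x) \<le> 2 * B"
      using norm_triangle_ineq4[of "\<phi> n x" "\<psi> x"] bound[OF that, of n] \<psi>_bound[OF that] by simp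
    then have "(cmod (\<phi> n x - \<psi> x))\<^sup>2 \<le> (2 * B)\<^sup>2"
      by (intro power_mono) auto
    then show ?thesis
      by (simp add: d_def norm_power)
  qed
  have d_integrable: "integrable \<mu> (d n)" for n
    using d_meas d_bound by (rule integrable_bounded)
  have "(\<lambda>n. integral\<^sup>L \<mu> (d n)) \<longlonglongrightarrow> (\<integral>x. 0 \<partial>\<mu>)"
  proof (rule integral_bounded_convergence[OF d_meas _ d_bound])
    show "(\<lambda>n. d n x) \<longlonglongrightarrow> 0" if "x \<in> {-pi<..pi}" for x
    proof -
      have "(\<lambda>n. d n x) \<longlonglongrightarrow> complex_of_real ((cmod (\<psi> x - \<psi> x))\<^sup>2)"
        unfolding d_def by (intro tendsto_intros lim that)
      then show ?thesis
        by simp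
    qed
  qed auto
  then have "(\<lambda>n. complex_of_real (\<integral>x. (cmod (\<phi> n x - \<psi> x))\<^sup>2 \<partial>\<mu>)) \<longlonglongrightarrow> complex_of_real 0"
    unfolding d_def integral_complex_of_real by (simp del: of_real_power)
  then have "(\<lambda>n. \<integral>x. (cmod (\<phi> n x - \<psi> x))\<^sup>2 \<partial>\<mu>) \<longlonglongrightarrow> 0"
    by (simp only: tendsto_of_real_iff)
  then have small: "\<exists>N. \<forall>n\<ge>N. (\<integral>x. (cmod (\<phi> n x - \<psi> x))\<^sup>2 \<partial>\<mu>) < e" if "e > 0" for e
    using that by (force dest: LIMSEQ_D[where r = e])
  have real_integrable: "integrable \<mu> (\<lambda>x. (cmod (\<phi> n x - \<psi> x))\<^sup>2)" for n
    using d_integrable[of n] unfolding d_def by (simp only: complex_of_real_integrable_eq)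
  have le: "(L2_norm M (\<lambda>w. Y m w - Y n w))\<^sup>2
      \<le> 2 * (\<integral>x. (cmod (\<phi> m x - \<psi> x))\<^sup>2 \<partial>\<mu>) + 2 * (\<integral>x. (cmod (\<phi> n x - \<psi> x))\<^sup>2 \<partial>\<mu>)" for m n
  proof -
    have "(L2_norm M (\<lambda>w. Y m w - Y n w))\<^sup>2 = (\<integral>x. (cmod (\<phi> m x - \<phi> n x))\<^sup>2 \<partial>\<mu>)"
      by (rule spectral_norm[OF spectral_diff[OF Y Y]])
    also have "\<dots> \<le> (\<integral>x. 2 * (cmod (\<phi> m x - \<psi> x))\<^sup>2 + 2 * (cmod (\<phi> n x - \<psi> x))\<^sup>2 \<partial>\<mu>)"
    proof (rule integral_mono_AE')
      show "integrable \<mu> (\<lambda>x. 2 * (cmod (\<phi> m x - \<psi> x))\<^sup>2 + 2 * (cmod (\<phi> n x - \<psi> x))\<^sup>2)"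
        using real_integrable by simp
      have "(cmod (\<phi> m x - \<phi> n x))\<^sup>2 \<le> 2 * (cmod (\<phi> m x - \<psi> x))\<^sup>2 + 2 * (cmod (\<phi> n x - \<psi> x))\<^sup>2" for x
      proof -
        have "cmod (\<phi> m x - \<phi> n x) \<le> cmod (\<phi> m x - \<psi> x) + cmod (\<phi> n x - \<psi> x)"
          using norm_triangle_ineq4[of "\<phi> m x - \<psi> x" "\<phi> n x - \<psi> x"] by simp
        then have "(cmod (\<phi> m x - \<phi> n x))\<^sup>2 \<le> (cmod (\<phi> m x - \<psi> x) + cmod (\<phi> n x - \<psi> x))\<^sup>2"
          by (intro power_mono) auto
        also have "\<dots> \<le> 2 * (cmod (\<phi> m x - \<psi> x))\<^sup>2 + 2 * (cmod (\<phi> n x - \<psi> x))\<^sup>2"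
          using sum_squares_bound[of "cmod (\<phi> m x - \<psi> x)" "cmod (\<phi> n x - \<psi> x)"]
          by (simp add: power2_sum)
        finally show ?thesis .
      qed
      then show "AE x in \<mu>. (cmod (\<phi> m x - \<phi> n x))\<^sup>2 \<le> 2 * (cmod (\<phi> m x - \<psi> x))\<^sup>2 + 2 * (cmod (\<phi> n x - \<psi> x))\<^sup>2"
        by simp
    qed simp
    also have "\<dots> = 2 * (\<integral>x. (cmod (\<phi> m x - \<psi> x))\<^sup>2 \<partial>\<mu>) + 2 * (\<integral>x. (cmod (\<phi> n x - \<psi> x))\<^sup>2 \<partial>\<mu>)"
      using real_integrable by simp
    finally show ?thesis .
  qed
  obtain W where "W \<in> L2_elements M" "(\<lambda>n. L2_norm M (\<lambda>w. Y n w - W w)) \<longlonglongrightarrow> 0"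
  proof (rule L2_complete)
    show "Y n \<in> L2_elements M" for n
      by (rule spectral_L2[OF Y process_L2])
    fix e :: real assume "e > 0"
    then obtain N where N: "\<forall>n\<ge>N. (\<integral>x. (cmod (\<phi> n x - \<psi> x))\<^sup>2 \<partial>\<mu>) < e\<^sup>2 / 4"
      using small[of "e\<^sup>2 / 4"] by auto
    have "L2_norm M (\<lambda>w. Y m w - Y n w) < e" if "m \<ge> N" "n \<ge> N" for m n
    proof (rule power2_less_imp_less)
      show "(L2_norm M (\<lambda>w. Y m w - Y n w))\<^sup>2 < e\<^sup>2"
        using le[of m n] N[rule_format, OF that(1)] N[rule_format, OF that(2)] by linarith
    qed (use \<open>e > 0\<close> in simp)
    then show "\<exists>N. \<forall>m\<ge>N. \<forall>n\<ge>N. L2_norm M (\<lambda>w. Y m w - Y n w) < e"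
      by blast
  qed
  with Y bound lim \<psi> have "spectral M X \<psi> W"
    by (intro spectral.limit[of M X \<phi> Y B \<psi> W])
  then show thesis
    by (rule that)
qed

end

lemma spectral_cong:
  assumes "spectral M X \<phi> Y" "\<And>t. X t \<in> L2_elements M" "\<psi> \<in> borel_measurable borel"
    and "\<And>x. x \<in> {-pi<..pi} \<Longrightarrow> \<psi> x = \<phi> x"
  shows "spectral M X \<psi> Y"
proof -
  obtain B where "\<forall>x\<in>{-pi<..pi}. cmod (\<phi> x) \<le> B"
    using spectral_bounded[OF assms(1)] by blast
  then show ?thesis
    using assms spectral_L2[OF assms(1,2)]
    by (intro spectral.limit[of M X "\<lambda>_. \<phi>" "\<lambda>_. Y" B \<psi> Y]) (auto simp: L2_norm_def)
qed

section \<open>Stationary sequences have spectral measures\<close>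

lemma L2_elements_sum:
  "(\<And>i. i \<in> I \<Longrightarrow> Y i \<in> L2_elements M) \<Longrightarrow> (\<lambda>w. \<Sum>i\<in>I. Y i w) \<in> L2_elements M"
  by (induction I rule: infinite_finite_induct) (auto intro: L2_elementsI)

lemma L2_inner_sum_left:
  assumes "\<And>i. i \<in> I \<Longrightarrow> Y i \<in> L2_elements M" "W \<in> L2_elements M"
  shows "L2_inner M (\<lambda>w. \<Sum>i\<in>I. Y i w) W = (\<Sum>i\<in>I. L2_inner M (Y i) W)"
  using assms by (simp add: L2_inner_def cinner.sum_left L2_integrable_cinner)

lemma L2_inner_sum_right:
  assumes "\<And>i. i \<in> I \<Longrightarrow> Y i \<in> L2_elements M" "W \<in> L2_elements M"
  shows "L2_inner M W (\<lambda>w. \<Sum>i\<in>I. Y i w) = (\<Sum>i\<in>I. L2_inner M W (Y i))"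
  using assms by (simp add: L2_inner_def cinner.sum_right L2_integrable_cinner)

lemma L2_inner_scaleC_right: "L2_inner M Y (\<lambda>w. c *\<^sub>C W w) = cnj c * L2_inner M Y W"
  by (simp add: L2_inner_def cinner_scaleC_right)

text \<open>The autocovariance is positive definite because its quadratic forms are squared norms of linear
  combinations of the sequence; Herglotz' theorem then gives the measure.\<close>

lemma stationary_spectral_measure:
  fixes X :: "int \<Rightarrow> 'o \<Rightarrow> 'h::{complex_inner, banach, second_countable_topology}"
  assumes X: "\<And>t. X t \<in> L2_elements M"
    and stat: "\<And>t s. L2_inner M (X t) (X s) = L2_inner M (X (t - s)) (X 0)"
  obtains \<mu> where "spectral_measure M X \<mu>"
proof -
  define \<gamma> where "\<gamma> h = L2_inner M (X h) (X 0)" for h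
  have psd: "0 \<le> Re (\<Sum>j<N. \<Sum>l<N. c j * cnj (c l) * \<gamma> (int j - int l))" for N and c :: "nat \<Rightarrow> complex"
  proof -
    let ?S = "\<lambda>w. \<Sum>j<N. c j *\<^sub>C X (int j) w"
    have "(\<Sum>j<N. \<Sum>l<N. c j * cnj (c l) * \<gamma> (int j - int l)) = L2_inner M ?S ?S"
      by (subst L2_inner_sum_left) (auto intro!: L2_elements_sum X sum.cong
          simp: L2_inner_sum_right X L2_elements_scaleC L2_inner_scaleC_left L2_inner_scaleC_right
            \<gamma>_def stat[of "int _" "int _"] sum_distrib_left mult_ac)
    then show ?thesis 
      by (simp add: L2_inner_self)
  qed
  have herm: "\<gamma> (- h) = cnj (\<gamma> h)" for h
    unfolding \<gamma>_def using stat[of 0 h] L2_inner_commute[of M "X 0" "X h"] by simp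
  obtain \<mu> :: "real measure" where "finite_measure \<mu>" "sets \<mu> = sets borel"
    "AE x in \<mu>. x \<in> {-pi<..pi}" "\<And>h. \<gamma> h = integral\<^sup>L \<mu> (trig h)"
    using Herglotz[of \<gamma>, OF psd herm] by blast
  then show thesis
    using X stat unfolding \<gamma>_def by (intro that[of \<mu>] spectral_measure.intro) auto
qed

section \<open>Covariance operators\<close>

lemma norm_tensor_op: "norm ((x \<otimes>\<^sub>H y) g) = cmod (cinner g y) * norm x"
  by (simp add: tensor_op_def norm_scaleC)

lemma norm_tensor_op_le: "norm ((x \<otimes>\<^sub>H y) g) \<le> norm x * norm y * norm g"
proof -
  have "cmod (cinner g y) * norm x \<le> norm g * norm y * norm x"
    by (intro mult_right_mono norm_cinner_le norm_ge_zero)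
  then show ?thesis
    by (simp add: norm_tensor_op mult_ac)
qed

lemma integrable_tensor_op:
  assumes "Y \<in> L2_elements M" "W \<in> L2_elements M"
  shows "integrable M (\<lambda>w. (Y w \<otimes>\<^sub>H W w) g)"
proof (rule Bochner_Integration.integrable_bound)
  note [measurable] = assms[THEN L2_elements_measurable]
  show "integrable M (\<lambda>w. norm (Y w) * norm (W w) * norm g)"
    by (intro integrable_mult_left L2_integrable_norm_mult assms)
  show "(\<lambda>w. (Y w \<otimes>\<^sub>H W w) g) \<in> borel_measurable M"
    unfolding tensor_op_def by measurable
  show "AE w in M. norm ((Y w \<otimes>\<^sub>H W w) g) \<le> norm (norm (Y w) * norm (W w) * norm g)"
    using norm_tensor_op_le by (intro AE_I2) simp
qed

text \<open>The matrix elements of the covariance operator are scalar covariances of coordinates.\<close>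

lemma cinner_expect_tensor:
  assumes "Y \<in> L2_elements M" "W \<in> L2_elements M"
  shows "cinner (expect_tensor M Y W g) h = L2_inner M (\<lambda>w. cinner (Y w) h) (\<lambda>w. cinner (W w) g)"
proof -
  have "cinner (expect_tensor M Y W g) h = integral\<^sup>L M (\<lambda>w. cinner ((Y w \<otimes>\<^sub>H W w) g) h)"
    unfolding expect_tensor_def
    by (rule integral_bounded_linear[OF cinner.bounded_linear_left integrable_tensor_op[OF assms], symmetric])
  also have "\<dots> = L2_inner M (\<lambda>w. cinner (Y w) h) (\<lambda>w. cinner (W w) g)"
    unfolding L2_inner_def tensor_op_def
    by (intro Bochner_Integration.integral_cong refl)
      (simp add: cinner_scaleC_left cinner_complex_def cinner_commute[symmetric] mult.commute)
  finally show ?thesis .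
qed

lemma norm_cinner_expect_tensor_le:
  assumes "Y \<in> L2_elements M" "W \<in> L2_elements M"
  shows "cmod (cinner (expect_tensor M Y W g) h) \<le> L2_norm M Y * L2_norm M W * (norm g * norm h)"
proof -
  have "cmod (cinner (expect_tensor M Y W g) h)
      \<le> L2_norm M (\<lambda>w. cinner (Y w) h) * L2_norm M (\<lambda>w. cinner (W w) g)"
    unfolding cinner_expect_tensor[OF assms] by (intro norm_L2_inner_le L2_elements_cinner assms)
  also have "\<dots> \<le> (L2_norm M Y * norm h) * (L2_norm M W * norm g)"
    by (intro mult_mono L2_norm_cinner_le assms) auto
  finally show ?thesis
    by (simp add: mult_ac)
qed

lemma bounded_clinear_expect_tensor:
  assumes "Y \<in> L2_elements M" "W \<in> L2_elements M"
  shows "bounded_clinear (expect_tensor M Y W)"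
  unfolding bounded_clinear_def
proof (intro conjI allI)
  note int = integrable_tensor_op[OF assms]
  show scale: "expect_tensor M Y W (c *\<^sub>C g) = c *\<^sub>C expect_tensor M Y W g" for c g
  proof -
    have "expect_tensor M Y W (c *\<^sub>C g) = integral\<^sup>L M (\<lambda>w. c *\<^sub>C (Y w \<otimes>\<^sub>H W w) g)"
      by (simp add: expect_tensor_def tensor_op_def cinner_scaleC_left scaleC_scaleC)
    also have "\<dots> = c *\<^sub>C expect_tensor M Y W g"
      unfolding expect_tensor_def by (rule integral_bounded_linear[OF scaleC.bounded_linear_right int])
    finally show ?thesis .
  qed
  show "bounded_linear (expect_tensor M Y W)"
  proof (rule bounded_linear_intro)
    show "expect_tensor M Y W (g + h) = expect_tensor M Y W g + expect_tensor M Y W h" for g h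
    proof -
      have "(\<lambda>w. (Y w \<otimes>\<^sub>H W w) (g + h)) = (\<lambda>w. (Y w \<otimes>\<^sub>H W w) g + (Y w \<otimes>\<^sub>H W w) h)"
        by (simp add: tensor_op_def cinner_add_left scaleC_add_left)
      then show ?thesis
        unfolding expect_tensor_def using int by simp
    qed
    show "expect_tensor M Y W (r *\<^sub>R g) = r *\<^sub>R expect_tensor M Y W g" for r g
      by (simp add: scaleR_scaleC scale)
    show "norm (expect_tensor M Y W g) \<le> norm g * integral\<^sup>L M (\<lambda>w. norm (Y w) * norm (W w))" for g
    proof -
      have "norm (expect_tensor M Y W g) \<le> integral\<^sup>L M (\<lambda>w. norm ((Y w \<otimes>\<^sub>H W w) g))"
        unfolding expect_tensor_def by (rule integral_norm_bound)
      also have "\<dots> \<le> integral\<^sup>L M (\<lambda>w. norm (Y w) * norm (W w) * norm g)"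
        by (intro integral_mono integrable_norm int integrable_mult_left L2_integrable_norm_mult assms
            norm_tensor_op_le)
      finally show ?thesis
        by (simp add: mult.commute)
    qed
  qed
qed

lemma Bessel_inequality:
  assumes "finite F" "\<And>e f. e \<in> F \<Longrightarrow> f \<in> F \<Longrightarrow> cinner e f = (if e = f then 1 else 0)"
  shows "(\<Sum>e\<in>F. (cmod (cinner x e))\<^sup>2) \<le> (norm x)\<^sup>2"
proof -
  let ?S = "\<Sum>e\<in>F. cinner x e *\<^sub>C e" and ?B = "\<Sum>e\<in>F. (cmod (cinner x e))\<^sup>2"
  have xS: "cinner x ?S = complex_of_real ?B"
    unfolding cinner.sum_right of_real_sum
    by (intro sum.cong refl) (simp only: cinner_scaleC_right complex_norm_square mult.commute)
  have "cinner e ?S = cnj (cinner x e)" if "e \<in> F" for e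
  proof -
    have "cinner e ?S = (\<Sum>f\<in>F. if e = f then cnj (cinner x f) else 0)"
      unfolding cinner.sum_right
      by (intro sum.cong refl) (simp add: cinner_scaleC_right assms(2) that)
    then show ?thesis
      using assms(1) that by simp
  qed
  then have SS: "cinner ?S ?S = complex_of_real ?B"
    unfolding cinner.sum_left[of _ _ ?S] of_real_sum
    by (intro sum.cong refl) (simp only: cinner_scaleC_left complex_norm_square)
  have "0 \<le> (norm (x + (- 1) *\<^sub>C ?S))\<^sup>2"
    by simp
  also have "\<dots> = (norm x)\<^sup>2 - ?B"
    unfolding norm_add_square using xS SS
    by (simp add: cinner_scaleC_right norm_scaleC norm_eq_sqrt_cinner[of ?S] cinner_ge_zero sum_nonneg)
  finally show ?thesis
    by simp
qed

lemma nonneg_self_adjoint_is_own_modulus: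
  assumes "bounded_clinear T" "nonneg_definite T" "\<And>x y. cinner (T x) y = cinner x (T y)"
  shows "is_modulus T T"
  using assms by (simp add: is_modulus_def)

text \<open>A covariance operator is self-adjoint and non-negative, hence its own modulus, and Bessel's
  inequality under the expectation bounds its trace by the second moment.\<close>

lemma covariance_trace_class:
  assumes Y: "Y \<in> L2_elements M"
  shows "expect_tensor M Y Y \<in> trace_class_nonneg"
proof -
  let ?C = "expect_tensor M Y Y"
  have diag: "cinner (?C g) g = complex_of_real ((L2_norm M (\<lambda>w. cinner (Y w) g))\<^sup>2)" for g
    by (simp only: cinner_expect_tensor[OF Y Y] L2_inner_self)
  have nonneg: "nonneg_definite ?C"
    unfolding nonneg_definite_def diag by (simp del: of_real_power)
  have self_adjoint: "cinner (?C x) y = cinner x (?C y)" for x y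
    by (subst cinner_commute[of x]) (simp only: cinner_expect_tensor[OF Y Y] L2_inner_commute[symmetric])
  have modulus: "is_modulus ?C ?C"
    using bounded_clinear_expect_tensor[OF Y Y] nonneg self_adjoint
    by (rule nonneg_self_adjoint_is_own_modulus)
  have "(\<lambda>e. cinner (?C e) e) summable_on E" if E: "orthonormal_basis E" for E
  proof -
    let ?f = "\<lambda>e. (L2_norm M (\<lambda>w. cinner (Y w) e))\<^sup>2"
    have "sum ?f F \<le> (L2_norm M Y)\<^sup>2" if "finite F" "F \<subseteq> E" for F
    proof -
      have orthonormal: "cinner e f = (if e = f then 1 else 0)" if "e \<in> F" "f \<in> F" for e f
        using E that \<open>F \<subseteq> E\<close> unfolding orthonormal_basis_def by (meson subsetD)
      have "sum ?f F = integral\<^sup>L M (\<lambda>w. \<Sum>e\<in>F. (cmod (cinner (Y w) e))\<^sup>2)"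
        unfolding L2_norm_square
        by (rule Bochner_Integration.integral_sum[symmetric])
          (intro L2_elements_integrable L2_elements_cinner Y)
      also have "\<dots> \<le> integral\<^sup>L M (\<lambda>w. (norm (Y w))\<^sup>2)"
        by (intro integral_mono Bochner_Integration.integrable_sum L2_elements_integrable
            L2_elements_cinner Y Bessel_inequality \<open>finite F\<close> orthonormal)
      finally show ?thesis
        by (simp add: L2_norm_square)
    qed
    then have "?f summable_on E"
      by (intro nonneg_bdd_above_summable_on bdd_aboveI2[where M = "(L2_norm M Y)\<^sup>2"]) auto
    then show ?thesis
      unfolding diag by (intro summable_on_of_real)
  qed
  then show ?thesis
    using bounded_clinear_expect_tensor[OF Y Y] modulus nonneg
    by (auto simp: trace_class_nonneg_def trace_class_def)
qed

section \<open>Covariances of a weakly stationary sequence\<close>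

text \<open>Polarisation of the norm identity gives the real parts, and replacing \<open>x\<close> by \<open>-\<i> x\<close> the imaginary
  parts.\<close>

lemma Parseval_identity:
  fixes e :: "nat \<Rightarrow> 'a :: complex_inner"
  assumes Parseval: "\<And>x. (\<lambda>n. (cmod (cinner x (e n)))\<^sup>2) sums (norm x)\<^sup>2"
  shows "(\<lambda>n. cinner x (e n) * cnj (cinner y (e n))) sums cinner x y"
proof -
  have Re_sums: "(\<lambda>n. Re (cinner x (e n) * cnj (cinner y (e n)))) sums Re (cinner x y)" for x
  proof -
    have "(\<lambda>n. ((cmod (cinner (x + y) (e n)))\<^sup>2 - (cmod (cinner x (e n)))\<^sup>2 - (cmod (cinner y (e n)))\<^sup>2) / 2)
        sums (((norm (x + y))\<^sup>2 - (norm x)\<^sup>2 - (norm y)\<^sup>2) / 2)"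
      by (intro sums_divide sums_diff Parseval)
    then show ?thesis
      unfolding cinner_add_left norm_add_square
      by (simp add: cinner_complex_def add_divide_distrib)
  qed
  have "(\<lambda>n. Im (cinner x (e n) * cnj (cinner y (e n)))) sums Im (cinner x y)"
    using Re_sums[of "(- \<i>) *\<^sub>C x"] by (simp add: cinner_scaleC_left)
  with Re_sums[of x] show ?thesis
    by (simp add: sums_complex_iff)
qed

lemma L2_inner_coordinates:
  fixes e :: "nat \<Rightarrow> 'h::{complex_inner, banach, second_countable_topology}"
  assumes Y: "Y \<in> L2_elements M" and W: "W \<in> L2_elements M"
    and Parseval: "\<And>x. (\<lambda>n. (cmod (cinner x (e n)))\<^sup>2) sums (norm x)\<^sup>2"
  shows "(\<lambda>n. L2_inner M (\<lambda>w. cinner (Y w) (e n)) (\<lambda>w. cinner (W w) (e n))) sums L2_inner M Y W"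
proof -
  note [measurable] = L2_elements_measurable[OF Y] L2_elements_measurable[OF W]
  let ?s = "\<lambda>n w. \<Sum>k<n. cinner (Y w) (e k) * cnj (cinner (W w) (e k))"
  have "(\<lambda>n. integral\<^sup>L M (?s n)) \<longlonglongrightarrow> integral\<^sup>L M (\<lambda>w. cinner (Y w) (W w))"
  proof (rule integral_dominated_convergence[where w = "\<lambda>w. (norm (Y w))\<^sup>2 + (norm (W w))\<^sup>2"])
    show "integrable M (\<lambda>w. (norm (Y w))\<^sup>2 + (norm (W w))\<^sup>2)"
      using Y W by (simp add: L2_elements_integrable)
    show "AE w in M. (\<lambda>n. ?s n w) \<longlonglongrightarrow> cinner (Y w) (W w)"
      using Parseval_identity[OF Parseval] by (simp add: sums_def)
    have "cmod (?s n w) \<le> (norm (Y w))\<^sup>2 + (norm (W w))\<^sup>2" for n w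
    proof -
      have "cmod (?s n w) \<le> (\<Sum>k<n. (cmod (cinner (Y w) (e k)))\<^sup>2 + (cmod (cinner (W w) (e k)))\<^sup>2)"
      proof (rule sum_norm_le)
        fix k
        have "2 * cmod (cinner (Y w) (e k)) * cmod (cinner (W w) (e k))
            \<le> (cmod (cinner (Y w) (e k)))\<^sup>2 + (cmod (cinner (W w) (e k)))\<^sup>2"
          by (rule sum_squares_bound)
        moreover have "0 \<le> cmod (cinner (Y w) (e k)) * cmod (cinner (W w) (e k))"
          by simp
        ultimately show "cmod (cinner (Y w) (e k) * cnj (cinner (W w) (e k)))
            \<le> (cmod (cinner (Y w) (e k)))\<^sup>2 + (cmod (cinner (W w) (e k)))\<^sup>2"
          unfolding norm_mult complex_mod_cnj by linarith
      qed
      also have "\<dots> \<le> (norm (Y w))\<^sup>2 + (norm (W w))\<^sup>2"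
        unfolding sum.distrib sums_unique[OF Parseval]
        by (intro add_mono sum_le_suminf) (auto intro: sums_summable[OF Parseval])
      finally show ?thesis .
    qed
    then show "AE w in M. norm (?s n w) \<le> (norm (Y w))\<^sup>2 + (norm (W w))\<^sup>2" for n
      by simp
  qed (use Y W in measurable)
  moreover have "integral\<^sup>L M (?s n)
      = (\<Sum>k<n. L2_inner M (\<lambda>w. cinner (Y w) (e k)) (\<lambda>w. cinner (W w) (e k)))" for n
    using L2_integrable_cinner[OF L2_elements_cinner[OF Y] L2_elements_cinner[OF W]]
    by (simp add: L2_inner_def cinner_complex_def)
  ultimately show ?thesis
    by (simp add: sums_def L2_inner_def)
qed

lemma weakly_stationary_L2: "weakly_stationary M X \<Longrightarrow> X t \<in> L2_elements M"
  by (simp add: weakly_stationary_def)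

lemma weakly_stationary_coordinates:
  assumes "weakly_stationary M X"
  shows "L2_inner M (\<lambda>w. cinner (X t w) h) (\<lambda>w. cinner (X s w) g)
    = L2_inner M (\<lambda>w. cinner (X (t - s) w) h) (\<lambda>w. cinner (X 0 w) g)"
proof -
  have "expect_tensor M (X t) (X s) = expect_tensor M (X (t - s)) (X 0)"
    using assms by (simp add: weakly_stationary_def)
  then show ?thesis
    using weakly_stationary_L2[OF assms] by (metis cinner_expect_tensor)
qed

text \<open>Stationarity of the operators gives stationarity of their traces, computed along a Parseval
  sequence.\<close>

lemma weakly_stationary_L2_inner:
  fixes X :: "int \<Rightarrow> 'o \<Rightarrow> 'h::{complex_inner, banach, second_countable_topology}"
  assumes "weakly_stationary M X"
  shows "L2_inner M (X t) (X s) = L2_inner M (X (t - s)) (X 0)"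
proof -
  obtain e :: "nat \<Rightarrow> 'h" where e: "\<And>x. (\<lambda>n. (cmod (cinner x (e n)))\<^sup>2) sums (norm x)\<^sup>2"
    using Parseval_sequence_exists by blast
  note coords = L2_inner_coordinates[OF weakly_stationary_L2[OF assms] weakly_stationary_L2[OF assms] e]
  show ?thesis
    using coords[of t s] coords[of "t - s" 0] unfolding weakly_stationary_coordinates[OF assms, of t _ s]
    by (rule sums_unique2)
qed

lemma weakly_stationary_spectral_measure:
  assumes "weakly_stationary M X"
  obtains \<mu> where "spectral_measure M X \<mu>"
  using stationary_spectral_measure[of X M, OF weakly_stationary_L2[OF assms] weakly_stationary_L2_inner[OF assms]]
  by blast

text \<open>The coordinate \<open>\<langle>X t, g\<rangle>\<close> is again a stationary sequence, now in \<open>\<complex>\<close>, because its covariances are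
  matrix elements of the covariance operators.\<close>

lemma weakly_stationary_coordinate_spectral_measure:
  assumes "weakly_stationary M X"
  obtains \<mu> where "spectral_measure M (\<lambda>t w. cinner (X t w) g) \<mu>"
  using stationary_spectral_measure[of "\<lambda>t w. cinner (X t w) g" M]
    L2_elements_cinner[OF weakly_stationary_L2[OF assms]] weakly_stationary_coordinates[OF assms]
  by blast

text \<open>Disjoint frequency bands give uncorrelated elements, in the operator sense: for the diagonal
  matrix elements this is the isometry for the scalar process of coordinates, and the diagonal of a
  sesquilinear form determines the form.\<close>

lemma spectral_orthogonal:
  assumes X: "weakly_stationary M X" and Y: "spectral M X \<phi> Y" and W: "spectral M X \<psi> W"
    and disjoint: "\<And>x. \<phi> x * cnj (\<psi> x) = 0"
  shows "cinner (expect_tensor M Y W g) h = 0"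
proof (rule sesquilinear_zero_diagonal[where s = "\<lambda>g h. cinner (expect_tensor M Y W g) h"])
  note L2 = weakly_stationary_L2[OF X]
  note YW = spectral_L2[OF Y L2] spectral_L2[OF W L2]
  have lin: "bounded_linear (expect_tensor M Y W)"
    "expect_tensor M Y W (c *\<^sub>C g) = c *\<^sub>C expect_tensor M Y W g" for c g
    using bounded_clinear_expect_tensor[OF YW] by (auto simp: bounded_clinear_def)
  show "cinner (expect_tensor M Y W (x + y)) z
      = cinner (expect_tensor M Y W x) z + cinner (expect_tensor M Y W y) z" for x y z
    by (simp add: linear_add[OF bounded_linear.linear[OF lin(1)]] cinner_add_left)
  show "cinner (expect_tensor M Y W (c *\<^sub>C x)) y = c * cinner (expect_tensor M Y W x) y" for c x y
    by (simp add: lin(2) cinner_scaleC_left)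
  show "cinner (expect_tensor M Y W x) x = 0" for x
  proof -
    obtain \<nu> where "spectral_measure M (\<lambda>t w. cinner (X t w) x) \<nu>"
      using weakly_stationary_coordinate_spectral_measure[OF X] by blast
    from spectral_measure.spectral_isometry[OF this spectral_cinner[OF Y L2] spectral_cinner[OF W L2]]
    show ?thesis
      by (simp add: cinner_expect_tensor[OF YW] disjoint)
  qed
qed (simp_all add: cinner_add_right cinner_scaleC_right)

section \<open>Partitions and Riemann--Stieltjes sums\<close>

lemma is_partition_mono:
  assumes "is_partition n p" "i \<le> j" "j \<le> n + 1"
  shows "p i \<le> p j"
  using assms(2,3)
proof (induction j rule: dec_induct)
  case (step j)
  then have "p j < p (j + 1)"
    using assms(1) by (simp add: is_partition_def)
  with step show ?case
    by simp
qed simp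

lemma is_partition_mem:
  assumes "is_partition n p" "i \<le> n + 1"
  shows "p i \<in> {-pi..pi}"
  using is_partition_mono[OF assms(1), of 0 i] is_partition_mono[OF assms(1), of i "n + 1"] assms
  by (simp add: is_partition_def)

lemma le_mesh: "i \<le> n \<Longrightarrow> p (i + 1) - p i \<le> mesh n p"
  unfolding mesh_def by (intro Max_ge) auto

lemma norm_trig_diff_le: "cmod (trig t x - trig t y) \<le> \<bar>of_int t\<bar> * \<bar>x - y\<bar>"
proof -
  have "trig t x - trig t y = trig t y * (cis (of_int t * (x - y)) - 1)"
    by (simp add: trig_def cis_mult algebra_simps)
  then have "cmod (trig t x - trig t y) = cmod (cis (of_int t * (x - y)) - 1)"
    by (simp add: norm_mult)
  also have "\<dots> \<le> \<bar>of_int t * (x - y)\<bar>"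
    using iexp_approx1[of "of_int t * (x - y)" 0] by (simp add: cis_conv_exp)
  finally show ?thesis
    by (simp add: abs_mult)
qed

text \<open>The indicators of the partition intervals sum to one on \<open>(-\<pi>, \<pi>]\<close>, so the difference is a convex
  combination of differences \<open>trig t (p i) - trig t x\<close>, where only intervals containing \<open>x\<close> have weight.\<close>

lemma trig_step_approximation:
  assumes p: "is_partition n p" and x: "x \<in> {-pi<..pi}"
  shows "cmod ((\<Sum>i\<le>n. trig t (p i) * (indicator {-pi<..p (i + 1)} x - indicator {-pi<..p i} x)) - trig t x)
    \<le> \<bar>of_int t\<bar> * mesh n p"
proof -
  define u :: "nat \<Rightarrow> real" where "u i = indicator {-pi<..p (i + 1)} x - indicator {-pi<..p i} x" for i
  have u: "(u i = 0) \<or> (u i = 1 \<and> p i < x \<and> x \<le> p (i + 1))" if "i \<le> n" for i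
    using is_partition_mono[OF p, of i "i + 1"] that x by (auto simp: u_def indicator_def)
  have "(\<Sum>i\<le>n. u i) = indicator {-pi<..p (n + 1)} x - indicator {-pi<..p 0} x"
    using sum_lessThan_telescope[of "\<lambda>i. indicator {-pi<..p i} x :: real" "Suc n"]
    by (simp add: u_def lessThan_Suc_atMost)
  then have sum_u: "(\<Sum>i\<le>n. u i) = 1"
    using p x by (simp add: is_partition_def)
  have u_complex: "indicator {-pi<..p (i + 1)} x - indicator {-pi<..p i} x = complex_of_real (u i)" for i
    by (simp add: u_def indicator_def)
  have "(\<Sum>i\<le>n. trig t (p i) * (indicator {-pi<..p (i + 1)} x - indicator {-pi<..p i} x)) - trig t x
      = (\<Sum>i\<le>n. trig t (p i) * u i) - trig t x * complex_of_real (\<Sum>i\<le>n. u i)"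
    unfolding u_complex sum_u by simp
  also have "\<dots> = (\<Sum>i\<le>n. (trig t (p i) - trig t x) * u i)"
    by (simp add: sum_distrib_left sum_subtractf ring_distribs)
  finally have eq: "(\<Sum>i\<le>n. trig t (p i) * (indicator {-pi<..p (i + 1)} x - indicator {-pi<..p i} x)) - trig t x
      = (\<Sum>i\<le>n. (trig t (p i) - trig t x) * u i)" .
  have "cmod (\<Sum>i\<le>n. (trig t (p i) - trig t x) * u i) \<le> (\<Sum>i\<le>n. \<bar>of_int t\<bar> * mesh n p * u i)"
  proof (rule sum_norm_le)
    fix i assume i: "i \<in> {..n}"
    have "cmod (trig t (p i) - trig t x) \<le> \<bar>of_int t\<bar> * mesh n p" if "p i < x" "x \<le> p (i + 1)"
    proof -
      have "\<bar>p i - x\<bar> \<le> mesh n p"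
        using le_mesh[of i n p] i that by auto
      then have "\<bar>real_of_int t\<bar> * \<bar>p i - x\<bar> \<le> \<bar>of_int t\<bar> * mesh n p"
        by (intro mult_left_mono) auto
      with norm_trig_diff_le[of t "p i" x] show ?thesis
        by linarith
    qed
    then show "cmod ((trig t (p i) - trig t x) * complex_of_real (u i)) \<le> \<bar>of_int t\<bar> * mesh n p * u i"
      using u[of i] i by (auto simp: norm_mult)
  qed
  also have "\<dots> = \<bar>of_int t\<bar> * mesh n p"
    by (simp add: sum_distrib_left[symmetric] sum_u)
  finally show ?thesis
    unfolding eq .
qed

section \<open>The spectral representation\<close>

context spectral_measure
begin

text \<open>For \<open>a = \<pi>\<close> the indicator is the constant \<open>trig 0\<close> on \<open>(-\<pi>, \<pi>]\<close>, which corresponds to \<open>X 0\<close>.\<close>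

lemma spectral_band_exists:
  assumes "prob_space M" and a: "a \<in> {-pi..pi}"
  obtains Z where "spectral M X (indicator {-pi<..a}) Z"
proof (cases "a = pi")
  case True
  have "spectral M X (indicator {-pi<..pi}) (X 0)"
    by (rule spectral_cong[OF spectral.base[of M X 0] process_L2]) (auto simp: trig_zero)
  with True that show thesis
    by simp
next
  case False
  then have "a \<in> {-pi..<pi}"
    using a by auto
  from trig_poly_approximates_arc[OF this] obtain \<phi> where \<phi>: "\<And>n. trig_poly (\<phi> n)"
    "\<And>n x. cmod (\<phi> n x) \<le> 2" "\<And>x. x \<in> {-pi<..pi} \<Longrightarrow> (\<lambda>n :: nat. \<phi> n x) \<longlonglongrightarrow> indicator {..a} x"
    by blast
  have lim: "(\<lambda>n. \<phi> n x) \<longlonglongrightarrow> indicator {-pi<..a} x" if "x \<in> {-pi<..pi}" for x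
    using \<phi>(3)[OF that] that by (simp add: indicator_def)
  show thesis
    by (rule spectral_limit_exists[OF assms(1) trig_poly_spectral[OF \<phi>(1)] \<phi>(2) lim _ that]) auto
qed

lemma spectral_band_norm:
  assumes "spectral M X (indicator {a<..b}) Y"
  shows "L2_norm M Y = sqrt (measure \<mu> {a<..b})"
proof -
  have "(L2_norm M Y)\<^sup>2 = integral\<^sup>L \<mu> (indicator {a<..b})"
    unfolding spectral_norm[OF assms]
    by (intro Bochner_Integration.integral_cong refl) (simp add: indicator_def)
  also have "\<dots> = measure \<mu> {a<..b}"
    using sets_spectral_measure sets_eq_imp_space_eq[OF sets_spectral_measure] by simp
  finally show ?thesis
    by (simp add: real_sqrt_unique)
qed

lemma tendsto_measure_right: "((\<lambda>\<epsilon>. measure \<mu> {a<..a + \<epsilon>}) \<longlongrightarrow> 0) (at_right 0)"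
proof -
  interpret finite_borel_measure \<mu>
    using finite_spectral_measure sets_spectral_measure
    by (simp add: finite_borel_measure_def finite_borel_measure_axioms_def)
  have "(cdf \<mu> \<longlongrightarrow> cdf \<mu> a) (at_right a)"
    using cdf_is_right_cont by (simp add: continuous_within)
  then have "((\<lambda>\<epsilon>. cdf \<mu> (\<epsilon> + a) - cdf \<mu> a) \<longlongrightarrow> cdf \<mu> a - cdf \<mu> a) (at_right 0)"
    unfolding at_right_to_0[of a] filterlim_filtermap by (intro tendsto_intros)
  then have lim: "((\<lambda>\<epsilon>. cdf \<mu> (\<epsilon> + a) - cdf \<mu> a) \<longlongrightarrow> 0) (at_right 0)"
    by simp
  have "\<forall>\<^sub>F \<epsilon> in at_right 0. cdf \<mu> (\<epsilon> + a) - cdf \<mu> a = measure \<mu> {a<..a + \<epsilon>}"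
    using eventually_at_right_less[of 0] by eventually_elim (simp add: cdf_diff_eq add.commute)
  with lim show ?thesis
    by (rule Lim_transform_eventually)
qed

lemma spectral_norm_le:
  assumes Y: "spectral M X \<phi> Y" and bound: "\<And>x. x \<in> {-pi<..pi} \<Longrightarrow> cmod (\<phi> x) \<le> B" and "B \<ge> 0"
  shows "L2_norm M Y \<le> B * sqrt (measure \<mu> (space \<mu>))"
proof (rule power2_le_imp_le)
  have "(L2_norm M Y)\<^sup>2 \<le> (\<integral>x. B\<^sup>2 \<partial>\<mu>)"
    unfolding spectral_norm[OF Y]
  proof (rule integral_mono_AE')
    show "AE x in \<mu>. (cmod (\<phi> x))\<^sup>2 \<le> B\<^sup>2"
      using support by eventually_elim (intro power_mono bound norm_ge_zero)
    show "integrable \<mu> (\<lambda>x. B\<^sup>2)"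
      using finite_spectral_measure by (simp add: finite_measure.integrable_const)
  qed simp
  also have "\<dots> = (B * sqrt (measure \<mu> (space \<mu>)))\<^sup>2"
    by (simp add: power_mult_distrib)
  finally show "(L2_norm M Y)\<^sup>2 \<le> (B * sqrt (measure \<mu> (space \<mu>)))\<^sup>2" .
qed (use \<open>B \<ge> 0\<close> in simp)

text \<open>A Riemann--Stieltjes sum corresponds to a step function. By the isometry its distance to \<open>X t\<close> is the
  distance of the step function to \<open>trig t\<close> in \<open>L\<^sup>2(\<mu>)\<close>, and this is at most the uniform distance times
  the square root of the total mass.\<close>

lemma has_stochastic_integral_spectral:
  assumes Z: "\<And>a. a \<in> {-pi..pi} \<Longrightarrow> spectral M X (indicator {-pi<..a}) (Z a)"
  shows "has_stochastic_integral M (trig t) Z (X t)"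
  unfolding has_stochastic_integral_def
proof (intro conjI allI impI)
  show "X t \<in> L2_elements M"
    by (rule process_L2)
  fix \<epsilon> :: real assume "\<epsilon> > 0"
  define c where "c = sqrt (measure \<mu> (space \<mu>)) + 1"
  have c: "c > 0" "sqrt (measure \<mu> (space \<mu>)) \<le> c"
    by (auto simp: c_def intro: add_nonneg_pos)
  define K where "K = (\<bar>real_of_int t\<bar> + 1) * c"
  \<comment> \<open>The summands one keep \<open>K\<close> positive for \<open>t = 0\<close> and for a vanishing spectral measure.\<close>
  have "K > 0"
    using c by (auto simp: K_def intro!: mult_pos_pos)
  show "\<exists>\<delta>>0. \<forall>n p. is_partition n p \<longrightarrow> mesh n p < \<delta> \<longrightarrow>
      L2_norm M (\<lambda>w. stieltjes_sum (trig t) Z n p w - X t w) < \<epsilon>"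
  proof (intro exI conjI allI impI)
    show "\<epsilon> / K > 0"
      using \<open>\<epsilon> > 0\<close> \<open>K > 0\<close> by simp
    fix n p assume p: "is_partition n p" and mesh: "mesh n p < \<epsilon> / K"
    have mesh_nonneg: "0 \<le> mesh n p"
      using le_mesh[of 0 n p] is_partition_mono[OF p, of 0 1] by simp
    have "spectral M X
        (\<lambda>x. (\<Sum>i\<le>n. trig t (p i) * (indicator {-pi<..p (i + 1)} x - indicator {-pi<..p i} x)) - trig t x)
        (\<lambda>w. stieltjes_sum (trig t) Z n p w - X t w)"
      unfolding stieltjes_sum_def
      by (intro spectral_diff spectral_sum spectral.scale spectral.base Z is_partition_mem[OF p]) auto
    then have "L2_norm M (\<lambda>w. stieltjes_sum (trig t) Z n p w - X t w)
        \<le> \<bar>of_int t\<bar> * mesh n p * sqrt (measure \<mu> (space \<mu>))"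
      using trig_step_approximation[OF p] mesh_nonneg by (intro spectral_norm_le) auto
    also have "\<dots> \<le> (\<bar>real_of_int t\<bar> + 1) * mesh n p * c"
      using mesh_nonneg c by (intro mult_mono) auto
    also have "\<dots> = mesh n p * K"
      by (simp add: K_def mult_ac)
    also have "\<dots> < \<epsilon>"
      using mesh \<open>K > 0\<close> by (simp add: pos_less_divide_eq)
    finally show "L2_norm M (\<lambda>w. stieltjes_sum (trig t) Z n p w - X t w) < \<epsilon>" .
  qed
qed

end

theorem theorem4p5:
  fixes M :: "'o measure"
    and X :: "int \<Rightarrow> 'o \<Rightarrow> 'h::{complex_inner, banach, second_countable_topology}"
  assumes "prob_space M"
    and "weakly_stationary M X"
    and "zero_mean M X"
  shows "\<exists>Z :: real \<Rightarrow> 'o \<Rightarrow> 'h.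
    orthogonal_increment_process M Z \<and>
    ms_right_continuous M Z \<and>
    (\<forall>w\<in>space M. Z (-pi) w = 0) \<and>
    (\<forall>t. \<exists>I. has_stochastic_integral M (\<lambda>a. exp (\<i> * of_int t * of_real a)) Z I \<and>
      (AE w in M. X t w = I w))"
proof -
  interpret prob_space M
    by fact
  note X_L2 = weakly_stationary_L2[OF assms(2)]
  obtain \<mu> where "spectral_measure M X \<mu>"
    using weakly_stationary_spectral_measure[OF assms(2)] by blast
  then interpret spectral_measure M X \<mu> .
  \<comment> \<open>At \<open>-\<pi>\<close> the process must vanish at every sample point, while an arbitrary element corresponding to
    the zero function vanishes only almost surely.\<close>
  define Z where "Z a = (if a = - pi then (\<lambda>w. 0) else (SOME Y. spectral M X (indicator {-pi<..a}) Y))" for a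
  have Z: "spectral M X (indicator {-pi<..a}) (Z a)" if a: "a \<in> {-pi..pi}" for a
  proof (cases "a = -pi")
    case True
    then show ?thesis
      using spectral_cong[OF spectral_zero X_L2, of "indicator {-pi<..a}"] by (simp add: Z_def)
  next
    case False
    obtain Y where "spectral M X (indicator {-pi<..a}) Y"
      using spectral_band_exists[OF assms(1) a] by blast
    with False show ?thesis
      using someI[of "spectral M X (indicator {-pi<..a})" Y] by (simp add: Z_def)
  qed
  have Z_L2: "Z a \<in> L2_elements M" if "a \<in> {-pi..pi}" for a
    by (rule spectral_L2[OF Z[OF that] X_L2])
  have increment: "spectral M X (indicator {a<..b}) (\<lambda>w. Z b w - Z a w)"
    if "a \<in> {-pi..pi}" "b \<in> {-pi..pi}" "a \<le> b" for a b
    by (rule spectral_cong[OF spectral_diff[OF Z[OF that(2)] Z[OF that(1)]] X_L2])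
      (use that in \<open>auto simp: indicator_def\<close>)
  have continuous: "((\<lambda>\<epsilon>. L2_norm M (\<lambda>w. Z (a + \<epsilon>) w - Z a w)) \<longlongrightarrow> 0) (at_right 0)" if a: "a \<in> {-pi..<pi}" for a
  proof (rule Lim_transform_eventually)
    show "((\<lambda>\<epsilon>. sqrt (measure \<mu> {a<..a + \<epsilon>})) \<longlongrightarrow> 0) (at_right 0)"
      using tendsto_real_sqrt[OF tendsto_measure_right] by simp
    have "\<forall>\<^sub>F \<epsilon> in at_right 0. \<epsilon> < pi - a"
      using a by (intro eventually_at_rightI[of 0 "pi - a"]) auto
    then show "\<forall>\<^sub>F \<epsilon> in at_right 0. sqrt (measure \<mu> {a<..a + \<epsilon>}) = L2_norm M (\<lambda>w. Z (a + \<epsilon>) w - Z a w)"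
      using eventually_at_right_less[of 0]
    proof eventually_elim
      case (elim \<epsilon>)
      then show ?case
        using a by (intro spectral_band_norm[symmetric] increment) auto
    qed
  qed
  have "orthogonal_increment_process M Z"
    unfolding orthogonal_increment_process_def
  proof (intro conjI ballI allI impI)
    fix a :: real assume a: "a \<in> {-pi..pi}"
    show "Z a \<in> L2_elements M"
      by (rule Z_L2[OF a])
    show "expect_tensor M (Z a) (Z a) \<in> trace_class_nonneg"
      by (rule covariance_trace_class[OF Z_L2[OF a]])
    have "integral\<^sup>L M (Z a) = 0"
      using assms(3) by (intro spectral_zero_mean[OF Z[OF a] X_L2]) (simp add: zero_mean_def)
    then show "integral\<^sup>L M (\<lambda>w. cinner (Z a w) g) = 0" for g
      by (subst integral_bounded_linear[OF cinner.bounded_linear_left L2_integrable[OF Z_L2[OF a]]])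
        (simp add: cinner.zero_left)
  next
    fix a1 a2 a3 a4 :: real and g1 g2 :: 'h
    assume a: "a1 \<in> {-pi..pi}" "a2 \<in> {-pi..pi}" "a3 \<in> {-pi..pi}" "a4 \<in> {-pi..pi}"
      and le: "a1 \<le> a2" "a3 \<le> a4" and disjoint: "{a1<..a2} \<inter> {a3<..a4} = {}"
    show "cinner (expect_tensor M (\<lambda>w. Z a4 w - Z a3 w) (\<lambda>w. Z a2 w - Z a1 w) g1) g2 = 0"
      by (rule spectral_orthogonal[OF assms(2) increment[OF a(3,4) le(2)] increment[OF a(1,2) le(1)]])
        (use disjoint in \<open>auto simp: indicator_def\<close>)
  next
    fix a :: real and g1 g2 :: 'h
    assume a: "a \<in> {-pi..<pi}"
    let ?D = "\<lambda>\<epsilon> w. Z (a + \<epsilon>) w - Z a w"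
    show "((\<lambda>\<epsilon>. cinner (expect_tensor M (?D \<epsilon>) (?D \<epsilon>) g1) g2) \<longlongrightarrow> 0) (at_right 0)"
    proof (rule Lim_null_comparison)
      have "\<forall>\<^sub>F \<epsilon> in at_right 0. \<epsilon> < pi - a"
        using a by (intro eventually_at_rightI[of 0 "pi - a"]) auto
      then show "\<forall>\<^sub>F \<epsilon> in at_right 0. norm (cinner (expect_tensor M (?D \<epsilon>) (?D \<epsilon>) g1) g2)
          \<le> L2_norm M (?D \<epsilon>) * L2_norm M (?D \<epsilon>) * (norm g1 * norm g2)"
        using eventually_at_right_less[of 0]
      proof eventually_elim
        case (elim \<epsilon>)
        then show ?case
          using a by (intro norm_cinner_expect_tensor_le L2_elements_diff Z_L2) auto
      qed
      show "((\<lambda>\<epsilon>. L2_norm M (?D \<epsilon>) * L2_norm M (?D \<epsilon>) * (norm g1 * norm g2)) \<longlongrightarrow> 0) (at_right 0)"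
        by (intro tendsto_mult_left_zero tendsto_mult_zero continuous a)
    qed
  qed
  moreover have "ms_right_continuous M Z"
    using continuous by (simp add: ms_right_continuous_def)
  moreover have "\<forall>w\<in>space M. Z (-pi) w = 0"
    by (simp add: Z_def)
  moreover have "\<exists>I. has_stochastic_integral M (\<lambda>a. exp (\<i> * of_int t * of_real a)) Z I \<and>
      (AE w in M. X t w = I w)" for t
    using has_stochastic_integral_spectral[OF Z, of t] unfolding trig_eq_exp[abs_def]
    by (intro exI[of _ "X t"]) simp
  ultimately show ?thesis
    by blast
qed

end
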